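(* Let $\Omega$ be a domain in $\mathbb C^d$ and let $\mu$ be a regular Borel positive measure on $\Omega$ such that the analytic functions in $L^2(\mu)$ form a closed subspace $L^2_a(\mu)$ on which point evaluations are continuous, with reproducing kernel $k^\mu$. Assume that for each compact subset $K$ of $\Omega$ there exists $c(K)>0$ with $\mu|K\ge c(K)V|K$. Let $b$ be any analytic row-contraction on $\Omega$ with $\|b(z_0)\|<1$ for some $z_0\in\Omega$. Then the linear span of $\{k^\mu_z:z\in\Omega\}$ is dense in $\mathcal H_{k^\mu}(b)$.
   Context: $V$ is Lebesgue measure on $\mathbb C^d$; $\mu|K\ge c(K)V|K$ means $\mu(E)\ge c(K)V(E)$ for all Borel $E\subset K$. $L^2_a(\mu)$ carries the norm of $L^2(\mu)$ and $k^\mu_z=k^\mu(\cdot,z)$. An analytic row-contraction on $\Omega$ is an analytic row-vector valued function $b:\Omega\to\ell^2$ with $\|b(z)\|_{\ell^2}\le1$ for all $z\in\Omega$; any such $b$ is a contractive multiplier from $L^2_a(\mu)\otimes\ell^2$ to $L^2_a(\mu)$. $\mathcal H_{k^\mu}(b)$ is the Hilbert function space on $\Omega$ with reproducing kernel $k^\mu(z,w)(1-b(z)b(w)^* )$, $b(z)b(w)^*=\langle b(z),b(w)\rangle_{\ell^2}$. The density claim includes that the span is contained in $\mathcal H_{k^\mu}(b)$. *)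

theory Defs
  imports "HOL-Analysis.Analysis"
begin

section \<open>Analytic functions on open subsets of complex d-space\<close>

definition analytic_function_on :: "(complex ^ 'd) set \<Rightarrow> (complex ^ 'd \<Rightarrow> complex) \<Rightarrow> bool" where
  "analytic_function_on \<Omega> f \<longleftrightarrow>
     (\<forall>z\<in>\<Omega>. \<exists>D. (f has_derivative D) (at z) \<and> (\<forall>c v. D (c *s v) = c * D v))"

definition domain_in_Cd :: "(complex ^ 'd) set \<Rightarrow> bool" where
  "domain_in_Cd \<Omega> \<longleftrightarrow> open \<Omega> \<and> connected \<Omega> \<and> \<Omega> \<noteq> {}"


section \<open>Square-summable sequences and analytic row-contractions\<close>

definition ell2 :: "(nat \<Rightarrow> complex) set" where
  "ell2 = {x. summable (\<lambda>n. (norm (x n))\<^sup>2)}"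

definition ell2_inner :: "(nat \<Rightarrow> complex) \<Rightarrow> (nat \<Rightarrow> complex) \<Rightarrow> complex" where
  "ell2_inner x y = (\<Sum>n. x n * cnj (y n))"

definition ell2_norm :: "(nat \<Rightarrow> complex) \<Rightarrow> real" where
  "ell2_norm x = sqrt (\<Sum>n. (norm (x n))\<^sup>2)"

text \<open>
  Complex Frechet differentiability with respect to the norm of \<open>ell2\<close>: the derivative at \<open>z\<close> is
  the complex-linear map sending \<open>h\<close> to the sum of the \<open>h $ j * a j\<close>, where \<open>a j\<close> is the
  \<open>j\<close>-th partial derivative, an element of \<open>ell2\<close>.
\<close>
definition ell2_analytic_on :: "(complex ^ 'd) set \<Rightarrow> (complex ^ 'd \<Rightarrow> nat \<Rightarrow> complex) \<Rightarrow> bool" where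
  "ell2_analytic_on \<Omega> b \<longleftrightarrow>
     (\<forall>z\<in>\<Omega>. b z \<in> ell2) \<and>
     (\<forall>z\<in>\<Omega>. \<exists>a. (\<forall>j. a j \<in> ell2) \<and>
        ((\<lambda>w. ell2_norm (\<lambda>n. b w n - b z n - (\<Sum>j\<in>UNIV. (w - z) $ j * a j n)) / norm (w - z))
           \<longlongrightarrow> 0) (at z))"

definition analytic_row_contraction ::
  "(complex ^ 'd) set \<Rightarrow> (complex ^ 'd \<Rightarrow> nat \<Rightarrow> complex) \<Rightarrow> bool" where
  "analytic_row_contraction \<Omega> b \<longleftrightarrow>
     ell2_analytic_on \<Omega> b \<and> (\<forall>z\<in>\<Omega>. ell2_norm (b z) \<le> 1)"


section \<open>Hilbert function spaces\<close>

text \<open>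
  A complex-valued function on \<open>X\<close> is represented by its extension by zero to the whole type, so
  that functions on \<open>X\<close> are equal iff they agree on \<open>X\<close>. Inner products are linear in the
  first argument.
\<close>
definition functions_on :: "'a set \<Rightarrow> ('a \<Rightarrow> complex) set" where
  "functions_on X = {f. \<forall>x. x \<notin> X \<longrightarrow> f x = 0}"

definition function_subspace :: "'a set \<Rightarrow> ('a \<Rightarrow> complex) set \<Rightarrow> bool" where
  "function_subspace X H \<longleftrightarrow>
     H \<subseteq> functions_on X \<and> (\<lambda>x. 0) \<in> H \<and>
     (\<forall>f\<in>H. \<forall>g\<in>H. (\<lambda>x. f x + g x) \<in> H) \<and>
     (\<forall>c. \<forall>f\<in>H. (\<lambda>x. c * f x) \<in> H)"

type_synonym 'a fun_inner = "('a \<Rightarrow> complex) \<Rightarrow> ('a \<Rightarrow> complex) \<Rightarrow> complex"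

text \<open>Conjugate symmetry forces \<open>ip f f\<close> to be real.\<close>
definition complex_inner_on :: "('a \<Rightarrow> complex) set \<Rightarrow> 'a fun_inner \<Rightarrow> bool" where
  "complex_inner_on H ip \<longleftrightarrow>
     (\<forall>f\<in>H. \<forall>g\<in>H. \<forall>h\<in>H. ip (\<lambda>x. f x + g x) h = ip f h + ip g h) \<and>
     (\<forall>c. \<forall>f\<in>H. \<forall>g\<in>H. ip (\<lambda>x. c * f x) g = c * ip f g) \<and>
     (\<forall>f\<in>H. \<forall>g\<in>H. ip g f = cnj (ip f g)) \<and>
     (\<forall>f\<in>H. 0 \<le> Re (ip f f)) \<and>
     (\<forall>f\<in>H. ip f f = 0 \<longrightarrow> f = (\<lambda>x. 0))"

definition ip_norm :: "'a fun_inner \<Rightarrow> ('a \<Rightarrow> complex) \<Rightarrow> real" where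
  "ip_norm ip f = sqrt (Re (ip f f))"

definition complete_inner_on :: "('a \<Rightarrow> complex) set \<Rightarrow> 'a fun_inner \<Rightarrow> bool" where
  "complete_inner_on H ip \<longleftrightarrow>
     (\<forall>F :: nat \<Rightarrow> 'a \<Rightarrow> complex. (\<forall>n. F n \<in> H) \<longrightarrow>
        (\<forall>e>0. \<exists>N. \<forall>m\<ge>N. \<forall>n\<ge>N. ip_norm ip (\<lambda>x. F m x - F n x) < e) \<longrightarrow>
        (\<exists>f\<in>H. (\<lambda>n. ip_norm ip (\<lambda>x. F n x - f x)) \<longlonglongrightarrow> 0))"

definition bounded_point_evaluations ::
  "'a set \<Rightarrow> ('a \<Rightarrow> complex) set \<Rightarrow> 'a fun_inner \<Rightarrow> bool" where
  "bounded_point_evaluations X H ip \<longleftrightarrow>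
     (\<forall>x\<in>X. \<exists>C. \<forall>f\<in>H. norm (f x) \<le> C * ip_norm ip f)"

definition hilbert_function_space ::
  "'a set \<Rightarrow> ('a \<Rightarrow> complex) set \<Rightarrow> 'a fun_inner \<Rightarrow> bool" where
  "hilbert_function_space X H ip \<longleftrightarrow>
     function_subspace X H \<and> complex_inner_on H ip \<and> complete_inner_on H ip \<and>
     bounded_point_evaluations X H ip"

definition kernel_at :: "'a set \<Rightarrow> ('a \<Rightarrow> 'a \<Rightarrow> complex) \<Rightarrow> 'a \<Rightarrow> 'a \<Rightarrow> complex" where
  "kernel_at X k w = (\<lambda>z. if z \<in> X then k z w else 0)"

definition reproducing_kernel ::
  "'a set \<Rightarrow> ('a \<Rightarrow> complex) set \<Rightarrow> 'a fun_inner \<Rightarrow> ('a \<Rightarrow> 'a \<Rightarrow> complex) \<Rightarrow> bool" where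
  "reproducing_kernel X H ip k \<longleftrightarrow>
     (\<forall>w\<in>X. kernel_at X k w \<in> H \<and> (\<forall>f\<in>H. f w = ip f (kernel_at X k w)))"

definition function_span :: "('a \<Rightarrow> complex) set \<Rightarrow> ('a \<Rightarrow> complex) set" where
  "function_span S = {(\<lambda>x. \<Sum>f\<in>F. c f * f x) | c F. finite F \<and> F \<subseteq> S}"

definition dense_in_space ::
  "('a \<Rightarrow> complex) set \<Rightarrow> ('a \<Rightarrow> complex) set \<Rightarrow> 'a fun_inner \<Rightarrow> bool" where
  "dense_in_space S H ip \<longleftrightarrow>
     S \<subseteq> H \<and> (\<forall>f\<in>H. \<forall>e>0. \<exists>g\<in>S. ip_norm ip (\<lambda>x. f x - g x) < e)"


section \<open>Measures on a domain and the space of analytic square-integrable functions\<close>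

text \<open>
  Regularity means inner and outer regularity of every Borel set; finiteness on compact sets is
  not required.
\<close>
definition regular_borel_measure_on :: "'a::topological_space set \<Rightarrow> 'a measure \<Rightarrow> bool" where
  "regular_borel_measure_on X M \<longleftrightarrow>
     space M = X \<and> sets M = sets (restrict_space borel X) \<and>
     (\<forall>A\<in>sets M.
        emeasure M A = (INF U\<in>{U. openin (top_of_set X) U \<and> A \<subseteq> U}. emeasure M U) \<and>
        emeasure M A = (SUP K\<in>{K. compact K \<and> K \<subseteq> A}. emeasure M K))"

definition dominates_lebesgue_locally :: "(complex ^ 'd) set \<Rightarrow> (complex ^ 'd) measure \<Rightarrow> bool" where
  "dominates_lebesgue_locally \<Omega> M \<longleftrightarrow>
     (\<forall>K. compact K \<and> K \<subseteq> \<Omega> \<longrightarrow>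
        (\<exists>c::real. c > 0 \<and>
           (\<forall>E\<in>sets borel. E \<subseteq> K \<longrightarrow> ennreal c * emeasure lborel E \<le> emeasure M E)))"

text \<open>Representatives of the elements of the Lebesgue space; no passage to classes.\<close>
definition L2 :: "'a measure \<Rightarrow> ('a \<Rightarrow> complex) set" where
  "L2 M = {f. f \<in> borel_measurable M \<and> integrable M (\<lambda>x. (norm (f x))\<^sup>2)}"

definition L2_inner :: "'a measure \<Rightarrow> 'a fun_inner" where
  "L2_inner M f g = (\<integral>x. f x * cnj (g x) \<partial>M)"

definition L2a :: "(complex ^ 'd) set \<Rightarrow> (complex ^ 'd) measure \<Rightarrow> (complex ^ 'd \<Rightarrow> complex) set" where
  "L2a \<Omega> M = {f \<in> functions_on \<Omega>. analytic_function_on \<Omega> f \<and> f \<in> L2 M}"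

text \<open>Closedness modulo null functions: an L2-limit agrees a.e. with an element of \<open>A\<close>.\<close>
definition closed_in_L2 :: "'a measure \<Rightarrow> ('a \<Rightarrow> complex) set \<Rightarrow> bool" where
  "closed_in_L2 M A \<longleftrightarrow>
     (\<forall>F f. (\<forall>n::nat. F n \<in> A) \<longrightarrow> f \<in> L2 M \<longrightarrow>
        (\<lambda>n. ip_norm (L2_inner M) (\<lambda>x. F n x - f x)) \<longlonglongrightarrow> 0 \<longrightarrow>
        (\<exists>g\<in>A. AE x in M. g x = f x))"


section \<open>The kernel associated with a row-contraction\<close>

definition row_contraction_kernel ::
  "('a \<Rightarrow> 'a \<Rightarrow> complex) \<Rightarrow> ('a \<Rightarrow> nat \<Rightarrow> complex) \<Rightarrow> 'a \<Rightarrow> 'a \<Rightarrow> complex" where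
  "row_contraction_kernel k b z w = k z w * (1 - ell2_inner (b z) (b w))"

end

theory Submission
  imports Defs "HOL-Complex_Analysis.Complex_Analysis"
begin

text \<open>
  Let \<open>T\<close> be multiplication by the row \<open>b\<close> from \<open>L\<^sup>2\<^sub>a(\<mu>) \<otimes> \<ell>\<^sup>2\<close> to
  \<open>L\<^sup>2\<^sub>a(\<mu>)\<close>. On the span of the kernels, \<open>f = \<Sum> c\<^sub>x k\<^sub>x \<mapsto> \<Sum> c\<^sub>x k\<^sup>b\<^sub>x\<close> is \<open>1 - TT\<^sup>*\<close>,
  and the square of the norm of the image in \<open>H(b)\<close> is
  \<open>Q(f) = \<parallel>f\<parallel>\<^sup>2 - \<parallel>T\<^sup>*f\<parallel>\<^sup>2 = \<integral>(1 - \<parallel>b\<parallel>\<^sup>2)|f|\<^sup>2 d\<mu> + \<Sum>\<^sub>j \<parallel>H\<^sub>j f\<parallel>\<^sup>2\<close>, where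
  \<open>H\<^sub>j f\<close>, the component of \<open>cnj b\<^sub>j f\<close> orthogonal to \<open>L\<^sup>2\<^sub>a(\<mu>)\<close>, is a Hankel operator. By the maximum
  principle \<open>\<parallel>b\<parallel> < 1\<close> on \<open>\<Omega>\<close>, so \<open>Q\<close> dominates the Lebesgue \<open>L\<^sup>2\<close>-norm on compact sets and hence
  \<open>|f(z)|\<^sup>2 \<le> C Q(f)\<close>; by the Riesz theorem \<open>k\<^sub>z \<in> H(b)\<close>, and \<open>k\<^sub>z\<close> represents
  the functional \<open>(1 - TT\<^sup>*)f \<mapsto> f(z)\<close>.

  If \<open>u \<in> H(b)\<close> is orthogonal to all \<open>k\<^sub>z\<close>, approximate \<open>u\<close> by \<open>(1 - TT\<^sup>*)f\<^sub>n\<close>. Then \<open>f\<^sub>n \<rightarrow> 0\<close>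
  pointwise and \<open>f\<^sub>n\<close> is Cauchy for \<open>Q\<close>. The projections of \<open>cnj b\<^sub>j f\<^sub>n\<close> to \<open>L\<^sup>2\<^sub>a(\<mu>)\<close> converge locally
  uniformly to analytic functions \<open>g\<^sub>j\<close>, so \<open>H\<^sub>j f\<^sub>n \<rightarrow> -g\<^sub>j\<close> pointwise. By Fatou's lemma
  \<open>\<integral>(1 - \<parallel>b\<parallel>\<^sup>2)|f\<^sub>n|\<^sup>2 d\<mu> + \<Sum>\<^sub>j \<parallel>H\<^sub>j f\<^sub>n + g\<^sub>j\<parallel>\<^sup>2 \<rightarrow> 0\<close>, and since \<open>H\<^sub>j f\<^sub>n\<close> is
  orthogonal to \<open>g\<^sub>j\<close> this dominates \<open>Q(f\<^sub>n)\<close>; thus \<open>u = 0\<close>.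
\<close>

section \<open>Analytic functions of several complex variables\<close>

lemma norm_vector_scalar_mult: "norm (c *s (v :: complex ^ 'd)) = norm c * norm v"
  by (simp add: norm_vec_def L2_set_def norm_mult power_mult_distrib sum_distrib_left[symmetric] real_sqrt_mult)

lemma dist_add_vector_scalar_mult: "dist z (z + c *s (v :: complex ^ 'd)) = norm c * norm v"
  by (simp add: dist_norm norm_vector_scalar_mult)

text \<open>Complex scaling \<open>*s\<close> is not the real scaling of the vector type;
  bilinearity over the reals supplies its continuity and product rules.\<close>

lemma bounded_bilinear_vector_scalar_mult:
  "bounded_bilinear (\<lambda>c (v :: complex ^ 'd). c *s v)"
proof
  show "\<exists>K. \<forall>a b. norm (a *s (b :: complex ^ 'd)) \<le> norm a * norm b * K"
    by (rule exI[of _ 1]) (simp add: norm_vector_scalar_mult)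
qed (vector algebra_simps)+

lemmas continuous_on_vector_scalar_mult [continuous_intros] =
  bounded_bilinear.continuous_on[OF bounded_bilinear_vector_scalar_mult]

lemma analytic_function_on_imp_continuous_on:
  assumes "analytic_function_on \<Omega> f"
  shows "continuous_on \<Omega> f"
  using assms unfolding analytic_function_on_def
  by (meson continuous_at_imp_continuous_on has_derivative_continuous)

text \<open>The chain rule yields the real derivative \<open>h \<mapsto> D (h *s v)\<close>; complex
  linearity of \<open>D\<close> makes it multiplication by \<open>D v\<close>, hence a complex
  derivative along the line.\<close>

lemma analytic_function_on_slice:
  fixes f :: "complex ^ 'd \<Rightarrow> complex"
  assumes "(f has_derivative D) (at (z + \<zeta> *s v))" "\<And>c v. D (c *s v) = c * D v"
  shows "((\<lambda>\<zeta>. f (z + \<zeta> *s v)) has_field_derivative D v) (at \<zeta>)"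
proof -
  have "((\<lambda>\<zeta>. z + \<zeta> *s v) has_derivative (\<lambda>h. h *s v)) (at \<zeta>)"
    using bounded_bilinear.FDERIV[OF bounded_bilinear_vector_scalar_mult has_derivative_ident[of "at \<zeta>"] has_derivative_const[of v "at \<zeta>"]]
    by (auto intro!: derivative_eq_intros)
  from has_derivative_compose[OF this assms(1)]
  show ?thesis by (simp add: assms(2) has_field_derivative_def mult_commute_abs)
qed

lemma holomorphic_on_slice:
  assumes "analytic_function_on \<Omega> f" "\<And>\<zeta>. \<zeta> \<in> S \<Longrightarrow> z + \<zeta> *s v \<in> \<Omega>"
  shows "(\<lambda>\<zeta>. f (z + \<zeta> *s v)) holomorphic_on S"
  unfolding holomorphic_on_def
proof
  fix \<zeta> assume "\<zeta> \<in> S"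
  with assms obtain D where "(f has_derivative D) (at (z + \<zeta> *s v))" "\<And>c v. D (c *s v) = c * D v"
    unfolding analytic_function_on_def by meson
  from analytic_function_on_slice[OF this]
  show "(\<lambda>\<zeta>. f (z + \<zeta> *s v)) field_differentiable at \<zeta> within S"
    using field_differentiable_at_within field_differentiable_def by blast
qed

text \<open>Uniqueness of Haar measure: for translation-invariant \<open>M\<close>, Fubini evaluates
  \<open>M(A) L(B)\<close> as \<open>L(A) M(-B)\<close>; take for \<open>B\<close> the unit ball.\<close>
lemma lborel_distr_linear_isometry:
  fixes T :: "'a::euclidean_space \<Rightarrow> 'a"
  assumes "linear T" and iso: "\<And>x. norm (T x) = norm x"
  shows "distr lborel borel T = lborel"
proof -
  let ?L = "lborel :: 'a measure"
  define M where "M = distr ?L borel T"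
  have cont: "continuous_on UNIV T"
    using assms(1) linear_continuous_on linear_linear by blast
  then have [measurable]: "T \<in> borel \<rightarrow>\<^sub>M borel" by (rule borel_measurable_continuous_onI)
  have setsM [measurable_cong, simp]: "sets M = sets borel" and spM [simp]: "space M = UNIV" by (simp_all add: M_def)
  have inj: "inj T" using assms by (metis linear_injective_0 norm_eq_zero)
  then have surj: "surj T" using assms(1) linear_injective_imp_surjective by blast
  have emM: "emeasure M A = emeasure ?L (T -` A)" if "A \<in> sets borel" for A
    using that by (simp add: M_def emeasure_distr)
  \<comment> \<open>An isometry fixes every ball about the origin; this normalises \<open>M\<close>
    and also makes it \<sigma>-finite.\<close>
  have ball: "emeasure M (ball 0 r) = emeasure ?L (ball 0 r)" for r
    by (subst emM) (auto intro!: arg_cong[where f="emeasure ?L"] simp: iso)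
  interpret M: sigma_finite_measure M
  proof
    show "\<exists>A. countable A \<and> A \<subseteq> sets M \<and> \<Union>A = space M \<and> (\<forall>a\<in>A. emeasure M a \<noteq> \<infinity>)"
    proof (intro exI conjI)
      show "\<Union>(range (\<lambda>n::nat. ball (0::'a) (real n))) = space M"
        using reals_Archimedean2 by auto
      show "\<forall>a\<in>range (\<lambda>n. ball 0 (real n)). emeasure M a \<noteq> \<infinity>"
        using emeasure_lborel_ball_finite[of "0::'a"] by (auto simp: ball less_top)
    qed auto
  qed
  interpret P: pair_sigma_finite M ?L ..
  have invL: "(\<integral>\<^sup>+x. g (x + a) \<partial>?L) = (\<integral>\<^sup>+x. g x \<partial>?L)" if [measurable]: "g \<in> borel_measurable borel" for g a
  proof -
    have "(\<integral>\<^sup>+x. g x \<partial>?L) = (\<integral>\<^sup>+x. g x \<partial>distr ?L borel ((+) a))" by (simp add: lborel_distr_plus)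
    also have "\<dots> = (\<integral>\<^sup>+x. g (a + x) \<partial>?L)" by (subst nn_integral_distr) auto
    finally show ?thesis by (simp add: add.commute)
  qed
  have invM: "(\<integral>\<^sup>+x. g (x + a) \<partial>M) = (\<integral>\<^sup>+x. g x \<partial>M)" if [measurable]: "g \<in> borel_measurable borel" for g a
  proof -
    \<comment> \<open>Surjectivity pulls a translation by \<open>a\<close> back through
      \<open>T\<close> to a translation by \<open>a'\<close>, under which Lebesgue measure is
      invariant.\<close>
    obtain a' where a': "a = T a'" using surj by auto
    have "(\<integral>\<^sup>+x. g (x + a) \<partial>M) = (\<integral>\<^sup>+x. g (T x + a) \<partial>?L)"
      unfolding M_def by (subst nn_integral_distr) auto
    also have "\<dots> = (\<integral>\<^sup>+x. g (T (x + a')) \<partial>?L)" using assms(1) by (simp add: linear_add a')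
    also have "\<dots> = (\<integral>\<^sup>+x. g (T x) \<partial>?L)" by (rule invL) auto
    finally show ?thesis unfolding M_def by (subst nn_integral_distr) auto
  qed
  have "emeasure M A = emeasure ?L A" if [measurable]: "A \<in> sets borel" for A
  proof -
    let ?B = "ball (0::'a) 1"
    define \<alpha> \<beta> :: "'a \<Rightarrow> ennreal" where "\<alpha> = indicator A" and "\<beta> = indicator ?B"
    have [measurable]: "\<alpha> \<in> borel_measurable borel" "\<beta> \<in> borel_measurable borel"
      by (auto simp: \<alpha>_def \<beta>_def intro!: borel_measurable_indicator)
    have \<alpha>\<beta>: "(\<integral>\<^sup>+x. \<alpha> x \<partial>N) = emeasure N A" "(\<integral>\<^sup>+x. \<beta> x \<partial>N) = emeasure N ?B"
      if "sets N = sets borel" for N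
      using that by (simp_all add: \<alpha>_def \<beta>_def)
    have "emeasure M A * emeasure ?L ?B = (\<integral>\<^sup>+x. \<integral>\<^sup>+y. \<alpha> y * \<beta> x \<partial>M \<partial>?L)"
      by (simp add: nn_integral_multc nn_integral_cmult \<alpha>\<beta>)
    also have "\<dots> = (\<integral>\<^sup>+x. \<integral>\<^sup>+y. \<alpha> (y + x) * \<beta> x \<partial>M \<partial>?L)"
    proof (rule nn_integral_cong)
      fix x
      show "(\<integral>\<^sup>+y. \<alpha> y * \<beta> x \<partial>M) = (\<integral>\<^sup>+y. \<alpha> (y + x) * \<beta> x \<partial>M)"
        using invM[of "\<lambda>y. \<alpha> y * \<beta> x" x] by simp
    qed
    also have "\<dots> = (\<integral>\<^sup>+y. \<integral>\<^sup>+x. \<alpha> (y + x) * \<beta> x \<partial>?L \<partial>M)"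
      by (rule P.Fubini') measurable
    also have "\<dots> = (\<integral>\<^sup>+y. \<integral>\<^sup>+x. \<alpha> x * \<beta> (x - y) \<partial>?L \<partial>M)"
    proof (rule nn_integral_cong)
      fix y show "(\<integral>\<^sup>+x. \<alpha> (y + x) * \<beta> x \<partial>?L) = (\<integral>\<^sup>+x. \<alpha> x * \<beta> (x - y) \<partial>?L)"
        using invL[of "\<lambda>x. \<alpha> x * \<beta> (x - y)" y] by (simp add: add.commute)
    qed
    also have "\<dots> = (\<integral>\<^sup>+x. \<integral>\<^sup>+y. \<alpha> x * \<beta> (x - y) \<partial>M \<partial>?L)"
      by (rule P.Fubini'[symmetric]) measurable
    also have "\<dots> = (\<integral>\<^sup>+x. \<integral>\<^sup>+y. \<alpha> x * \<beta> y \<partial>M \<partial>?L)"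
    proof (rule nn_integral_cong)
      fix x
      \<comment> \<open>The ball is symmetric, so \<open>\<beta> (x - y) = \<beta> (y - x)\<close>,
        and translation invariance of \<open>M\<close> removes \<open>x\<close>.\<close>
      have "(\<integral>\<^sup>+y. \<beta> (x - y) \<partial>M) = (\<integral>\<^sup>+y. \<beta> (y + (- x)) \<partial>M)"
        by (intro nn_integral_cong) (auto simp: \<beta>_def indicator_def norm_minus_commute)
      also have "\<dots> = (\<integral>\<^sup>+y. \<beta> y \<partial>M)" by (rule invM) auto
      finally show "(\<integral>\<^sup>+y. \<alpha> x * \<beta> (x - y) \<partial>M) = (\<integral>\<^sup>+y. \<alpha> x * \<beta> y \<partial>M)"
        by (simp add: nn_integral_cmult)
    qed
    also have "\<dots> = emeasure ?L A * emeasure ?L ?B"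
      by (simp add: nn_integral_multc nn_integral_cmult \<alpha>\<beta> ball)
    finally have "emeasure M A * emeasure ?L ?B = emeasure ?L A * emeasure ?L ?B" .
    moreover have "emeasure ?L ?B \<noteq> \<infinity>" "emeasure ?L ?B \<noteq> 0"
      using emeasure_lborel_ball_finite[of "0::'a" 1] content_ball_pos[of 1 "0::'a"] by (auto simp: measure_def)
    ultimately show ?thesis
      by (simp add: mult.commute[of _ "emeasure ?L ?B"] ennreal_mult_cancel_left)
  qed
  then show ?thesis unfolding M_def[symmetric] by (intro measure_eqI) auto
qed

text \<open>The rotation about \<open>z\<close> is a translation, the isometry
  \<open>x \<mapsto> \<omega> *s x\<close> and a translation back, each preserving Lebesgue
  measure.\<close>

lemma nn_integral_rotate:
  fixes z :: "complex ^ 'd"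
  assumes "norm \<omega> = 1" and [measurable]: "G \<in> borel_measurable borel"
  shows "(\<integral>\<^sup>+x. G (z + \<omega> *s (x - z)) \<partial>lborel) = (\<integral>\<^sup>+x. G x \<partial>lborel)"
proof -
  have lin: "linear (\<lambda>x::complex^'d. \<omega> *s x)"
    using bounded_bilinear.bounded_linear_right[OF bounded_bilinear_vector_scalar_mult] bounded_linear.linear by blast
  have [measurable]: "(\<lambda>x::complex^'d. \<omega> *s x) \<in> borel \<rightarrow>\<^sub>M borel"
    by (intro borel_measurable_continuous_onI continuous_intros)
  have tr: "(\<integral>\<^sup>+x. g (a + x) \<partial>lborel) = (\<integral>\<^sup>+x. g x \<partial>lborel)" if [measurable]: "g \<in> borel_measurable borel" for g and a :: "complex^'d"
  proof -
    have "(\<integral>\<^sup>+x. g x \<partial>lborel) = (\<integral>\<^sup>+x. g x \<partial>distr lborel borel ((+) a))" by (simp add: lborel_distr_plus)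
    then show ?thesis by (subst (asm) nn_integral_distr) auto
  qed
  have "(\<integral>\<^sup>+x. G (z + \<omega> *s (x - z)) \<partial>lborel) = (\<integral>\<^sup>+x. G (z + \<omega> *s x) \<partial>lborel)"
    using tr[of "\<lambda>x. G (z + \<omega> *s x)" "- z"] by simp
  also have "\<dots> = (\<integral>\<^sup>+x. G (z + x) \<partial>distr lborel borel (\<lambda>x. \<omega> *s x))" by (subst nn_integral_distr) auto
  also have "\<dots> = (\<integral>\<^sup>+x. G (z + x) \<partial>lborel)"
    by (subst lborel_distr_linear_isometry[OF lin]) (auto simp: norm_vector_scalar_mult assms)
  also have "\<dots> = (\<integral>\<^sup>+x. G x \<partial>lborel)" by (rule tr) auto
  finally show ?thesis .
qed


section \<open>Mean value inequalities\<close>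

lemma circle_mean_value:
  assumes "g holomorphic_on cball 0 1"
  shows "((\<lambda>t. g (exp (2 * of_real pi * \<i> * of_real t))) has_integral g 0) {0..1}"
proof -
  have "((\<lambda>u. g u / (u - 0)) has_contour_integral (2 * of_real pi * \<i> * g 0)) (circlepath 0 1)"
    by (rule Cauchy_integral_circlepath_simple[OF assms]) simp
  then have "((\<lambda>x. (2 * of_real pi * \<i>) * g (exp (2 * of_real pi * \<i> * of_real x)))
      has_integral (2 * of_real pi * \<i> * g 0)) {0..1}"
    unfolding has_contour_integral vector_derivative_circlepath unfolding circlepath
    by (simp add: mult_ac)
  from has_integral_mult_right[OF this, of "1 / (2 * of_real pi * \<i>)"]
  show ?thesis by simp
qed

text \<open>The mean value property is applied to the holomorphic function \<open>g\<^sup>2\<close>,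
  so that taking norms under the integral suffices.\<close>

lemma norm_square_le_circle_mean:
  assumes "g holomorphic_on cball 0 1"
  shows "ennreal ((norm (g 0))\<^sup>2) \<le>
    (\<integral>\<^sup>+t. ennreal ((norm (g (exp (2 * of_real pi * \<i> * of_real t))))\<^sup>2) * indicator {0..1} t \<partial>lborel)"
proof -
  let ?e = "\<lambda>t. exp (2 * of_real pi * \<i> * of_real t) :: complex"
  have cont: "continuous_on {0..1::real} (\<lambda>t. g (?e t))"
  proof (rule continuous_on_compose2[OF holomorphic_on_imp_continuous_on[OF assms]])
    show "continuous_on {0..1} ?e" by (intro continuous_intros)
  qed (auto simp: norm_exp_eq_Re)
  have int: "(\<lambda>t. (norm (g (?e t)))\<^sup>2) integrable_on {0..1}"
    by (intro integrable_continuous_real continuous_intros cont)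
  have "((\<lambda>t. (g (?e t))\<^sup>2) has_integral (g 0)\<^sup>2) {0..1}"
    by (rule circle_mean_value) (intro holomorphic_intros assms)
  then have "norm ((g 0)\<^sup>2) \<le> integral {0..1} (\<lambda>t. (norm (g (?e t)))\<^sup>2)"
    by (metis (mono_tags, lifting) has_integral_integrable_integral int integral_norm_bound_integral norm_power order_refl)
  also have "ennreal (integral {0..1} (\<lambda>t. (norm (g (?e t)))\<^sup>2)) =
      (\<integral>\<^sup>+t. ennreal ((norm (g (?e t)))\<^sup>2) * indicator {0..1} t \<partial>lborel)"
    by (rule nn_integral_has_integral_lebesgue'[symmetric]) (use int in \<open>auto intro: integrable_integral\<close>)
  finally show ?thesis by (simp add: norm_power ennreal_leI)
qed

text \<open>Average the one-variable inequality on the slices through \<open>z\<close> over the ball, which is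
  invariant under the rotations \<open>x \<mapsto> z + e\<^sup>i\<^sup>t (x - z)\<close>.\<close>
lemma norm_square_le_ball_mean:
  fixes f :: "complex ^ 'd \<Rightarrow> complex"
  assumes f: "analytic_function_on \<Omega> f" and sub: "ball z r \<subseteq> \<Omega>"
  shows "ennreal ((norm (f z))\<^sup>2) * emeasure lborel (ball z r) \<le>
    (\<integral>\<^sup>+x. ennreal ((norm (f x))\<^sup>2) * indicator (ball z r) x \<partial>lborel)"
proof -
  let ?e = "\<lambda>t::real. exp (2 * of_real pi * \<i> * of_real t) :: complex"
  let ?B = "ball z r"
  \<comment> \<open>Cutting \<open>f\<close> off outside the ball gives a Borel function on the
    whole space, to which Fubini and the rotation invariance apply.\<close>
  define f0 where "f0 = (\<lambda>x. indicator ?B x *\<^sub>R f x)"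
  have [measurable]: "f0 \<in> borel_measurable borel"
    unfolding f0_def
    by (rule borel_measurable_continuous_on_indicator)
      (use continuous_on_subset[OF analytic_function_on_imp_continuous_on[OF f] sub] in auto)
  define G where "G = (\<lambda>x. ennreal ((norm (f0 x))\<^sup>2))"
  have [measurable]: "G \<in> borel_measurable borel" unfolding G_def by measurable
  have G: "G x = ennreal ((norm (f x))\<^sup>2) * indicator ?B x" for x
    by (auto simp: G_def f0_def indicator_def)
  have [measurable]: "(\<lambda>(x, t). z + ?e t *s (x - z)) \<in> borel \<Otimes>\<^sub>M borel \<rightarrow>\<^sub>M borel"
    unfolding borel_prod
    by (intro borel_measurable_continuous_onI) (auto simp: case_prod_beta intro!: continuous_intros)
  have "ennreal ((norm (f z))\<^sup>2) * emeasure lborel ?B = (\<integral>\<^sup>+x. ennreal ((norm (f z))\<^sup>2) * indicator ?B x \<partial>lborel)"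
    by (simp add: nn_integral_cmult_indicator)
  also have "\<dots> \<le> (\<integral>\<^sup>+x. \<integral>\<^sup>+t. G (z + ?e t *s (x - z)) * indicator {0..1} t \<partial>lborel \<partial>lborel)"
  proof (rule nn_integral_mono)
    fix x
    show "ennreal ((norm (f z))\<^sup>2) * indicator ?B x \<le> (\<integral>\<^sup>+t. G (z + ?e t *s (x - z)) * indicator {0..1} t \<partial>lborel)"
    proof (cases "x \<in> ?B")
      case True
      have inB: "z + \<zeta> *s (x - z) \<in> ?B" if "norm \<zeta> \<le> 1" for \<zeta>
      proof -
        have "norm \<zeta> * norm (x - z) \<le> 1 * norm (x - z)" using that by (intro mult_right_mono) auto
        then show ?thesis using True
          by (simp only: mem_ball dist_add_vector_scalar_mult) (simp add: dist_norm norm_minus_commute)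
      qed
      have hol: "(\<lambda>\<zeta>. f (z + \<zeta> *s (x - z))) holomorphic_on cball 0 1"
        by (rule holomorphic_on_slice[OF f]) (use inB sub in auto)
      show ?thesis
        using norm_square_le_circle_mean[OF hol] True inB by (simp add: G)
    qed simp
  qed
  also have "\<dots> = (\<integral>\<^sup>+t. \<integral>\<^sup>+x. G (z + ?e t *s (x - z)) * indicator {0..1} t \<partial>lborel \<partial>lborel)"
    by (rule lborel_pair.Fubini'[symmetric]) measurable
  also have "\<dots> = (\<integral>\<^sup>+t. (\<integral>\<^sup>+x. G (z + ?e t *s (x - z)) \<partial>lborel) * indicator {0..1::real} t \<partial>lborel)"
    by (intro nn_integral_cong nn_integral_multc) measurable
  also have "\<dots> = (\<integral>\<^sup>+t. (\<integral>\<^sup>+x. G x \<partial>lborel) * indicator {0..1::real} t \<partial>lborel)"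
    by (subst nn_integral_rotate) (auto simp: norm_exp_eq_Re)
  also have "\<dots> = (\<integral>\<^sup>+x. G x \<partial>lborel)"
    by (simp add: nn_integral_cmult_indicator)
  finally show ?thesis by (simp add: G)
qed

section \<open>Cauchy estimates and locally uniform limits\<close>

text \<open>Cauchy's inequality on the complex line through \<open>w\<close> in direction
  \<open>v\<close>. The parameter disc is chosen to reach only half of the radius
  \<open>\<rho>\<close>, so that its closure stays in the open ball; hence the factor 2.\<close>

lemma analytic_derivative_bound:
  fixes f :: "complex ^ 'd \<Rightarrow> complex"
  assumes f: "analytic_function_on \<Omega> f" and sub: "ball w \<rho> \<subseteq> \<Omega>" and "0 < \<rho>"
    and D: "(f has_derivative D) (at w)" "\<And>c v. D (c *s v) = c * D v"
    and B: "\<And>x. x \<in> ball w \<rho> \<Longrightarrow> norm (f x) \<le> B"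
  shows "norm (D v) \<le> 2 * B / \<rho> * norm v"
proof (cases "v = 0")
  case True
  then show ?thesis using D(1) has_derivative_linear linear_0 by fastforce
next
  case False
  define R where "R = \<rho> / (2 * norm v)"
  have R: "0 < R" using False assms(3) by (simp add: R_def)
  have in_ball: "w + \<zeta> *s v \<in> ball w \<rho>" if "norm \<zeta> \<le> R" for \<zeta>
  proof -
    have "norm \<zeta> * norm v \<le> R * norm v" using that by (intro mult_right_mono) auto
    also have "\<dots> < \<rho>" using False \<open>0 < \<rho>\<close> by (simp add: R_def)
    finally show ?thesis by (simp add: dist_norm norm_vector_scalar_mult)
  qed
  have hol: "(\<lambda>\<zeta>. f (w + \<zeta> *s v)) holomorphic_on cball 0 R"
    by (rule holomorphic_on_slice[OF f]) (use in_ball sub in auto)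
  have "norm ((deriv ^^ 1) (\<lambda>\<zeta>. f (w + \<zeta> *s v)) 0) \<le> fact 1 * B / R ^ 1"
    by (rule Cauchy_inequality)
      (use hol R in_ball B in \<open>auto intro: holomorphic_on_imp_continuous_on holomorphic_on_subset[OF hol]\<close>)
  moreover have "deriv (\<lambda>\<zeta>. f (w + \<zeta> *s v)) 0 = D v"
    by (rule DERIV_imp_deriv, rule analytic_function_on_slice) (use D in auto)
  ultimately show ?thesis using False by (simp add: R_def field_simps)
qed

text \<open>Weierstrass' theorem: by the Cauchy estimates the derivatives are uniformly Cauchy on a
  smaller ball, and differentiation then commutes with the limit.\<close>

lemma analytic_function_on_locally_uniform_limit:
  fixes f :: "nat \<Rightarrow> complex ^ 'd \<Rightarrow> complex"
  assumes f: "\<And>n. analytic_function_on \<Omega> (f n)"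
    and lim: "\<And>z. z \<in> \<Omega> \<Longrightarrow> \<exists>r>0. ball z r \<subseteq> \<Omega> \<and>
      (\<forall>e>0. \<exists>N. \<forall>m\<ge>N. \<forall>n\<ge>N. \<forall>w\<in>ball z r. norm (f m w - f n w) \<le> e)"
  obtains g where "analytic_function_on \<Omega> g" "\<And>z. z \<in> \<Omega> \<Longrightarrow> (\<lambda>n. f n z) \<longlonglongrightarrow> g z"
proof -
  obtain D where D: "\<And>n w. w \<in> \<Omega> \<Longrightarrow> (f n has_derivative D n w) (at w)"
      "\<And>n w c v. w \<in> \<Omega> \<Longrightarrow> D n w (c *s v) = c * D n w v"
    using f unfolding analytic_function_on_def by metis
  define g where "g = (\<lambda>z. lim (\<lambda>n. f n z))"
  have main: "(\<lambda>n. f n z) \<longlonglongrightarrow> g z \<and> (\<exists>D'. (g has_derivative D') (at z) \<and> (\<forall>c v. D' (c *s v) = c * D' v))"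
    if z: "z \<in> \<Omega>" for z
  proof -
    from lim[OF z] obtain r where r: "r > 0" "ball z r \<subseteq> \<Omega>"
      and C: "\<And>e. e > 0 \<Longrightarrow> \<exists>N. \<forall>m\<ge>N. \<forall>n\<ge>N. \<forall>w\<in>ball z r. norm (f m w - f n w) \<le> e"
      by blast
    let ?S = "ball z (r/2)"
    have SB: "ball w (r/2) \<subseteq> ball z r" if "w \<in> ?S" for w
    proof
      fix y assume "y \<in> ball w (r/2)"
      then show "y \<in> ball z r"
        using that dist_triangle[of z y w] by (simp add: dist_commute)
    qed
    have S: "?S \<subseteq> \<Omega>" using r by (metis (no_types, lifting) SB centre_in_ball half_gt_zero subset_iff)
    have DC: "\<exists>N. \<forall>m\<ge>N. \<forall>n\<ge>N. \<forall>w\<in>?S. \<forall>v. norm (D m w v - D n w v) \<le> e * norm v" if "e > 0" for e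
    proof -
      \<comment> \<open>Balls of radius \<open>r / 2\<close> are available about the points of
        \<open>?S\<close>, and the Cauchy estimate gives
        \<open>2 * (e * r / 4) / (r / 2) = e\<close>.\<close>
      have "e * r / 4 > 0" using that r by simp
      from C[OF this] obtain N where N: "\<And>m n w. m \<ge> N \<Longrightarrow> n \<ge> N \<Longrightarrow> w \<in> ball z r \<Longrightarrow> norm (f m w - f n w) \<le> e * r / 4"
        by blast
      have "norm (D m w v - D n w v) \<le> e * norm v" if mn: "m \<ge> N" "n \<ge> N" and w: "w \<in> ?S" for m n w v
      proof -
        have *: "\<exists>D'. ((\<lambda>x. f m x - f n x) has_derivative D') (at x) \<and> (\<forall>c v. D' (c *s v) = c * D' v)" if "x \<in> \<Omega>" for x
          using D[OF that] by (intro exI[of _ "\<lambda>v. D m x v - D n x v"]) (auto intro!: derivative_eq_intros simp: algebra_simps)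
        have "norm (D m w v - D n w v) \<le> 2 * (e * r / 4) / (r / 2) * norm v"
        proof (rule analytic_derivative_bound[where f="\<lambda>x. f m x - f n x" and \<Omega>=\<Omega> and D="\<lambda>v. D m w v - D n w v" and w=w])
          show "analytic_function_on \<Omega> (\<lambda>x. f m x - f n x)" using * unfolding analytic_function_on_def by blast
          show "ball w (r/2) \<subseteq> \<Omega>" using SB[OF w] r by blast
          show "((\<lambda>x. f m x - f n x) has_derivative (\<lambda>v. D m w v - D n w v)) (at w)"
            using D S w by (intro has_derivative_diff) auto
        qed (use r N[OF mn] SB[OF w] D S w in \<open>auto simp: right_diff_distrib\<close>)
        then show ?thesis using r by simp
      qed
      then show ?thesis by blast
    qed
    have conv: "(\<lambda>n. D n w v) \<longlonglongrightarrow> lim (\<lambda>n. D n w v)" if "w \<in> ?S" for w v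
    proof -
      have "Cauchy (\<lambda>n. D n w v)"
      proof (rule metric_CauchyI)
        fix e :: real assume "e > 0"
        \<comment> \<open>The added 1 covers \<open>v = 0\<close>.\<close>
        then have "e / (norm v + 1) > 0" by (simp add: add_nonneg_pos)
        from DC[OF this] obtain N where "\<And>m n. m \<ge> N \<Longrightarrow> n \<ge> N \<Longrightarrow> norm (D m w v - D n w v) \<le> e / (norm v + 1) * norm v"
          using \<open>w \<in> ?S\<close> by blast
        moreover have "e / (norm v + 1) * norm v < e"
        proof -
          have "norm v + 1 > 0" by (simp add: add_nonneg_pos)
          then show ?thesis
            using \<open>e > 0\<close> by (simp only: times_divide_eq_left pos_divide_less_eq) (simp add: distrib_left)
        qed
        ultimately show "\<exists>M. \<forall>m\<ge>M. \<forall>n\<ge>M. dist (D m w v) (D n w v) < e"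
          unfolding dist_norm by (intro exI[of _ N] allI impI) (rule le_less_trans)
      qed
      then show ?thesis by (simp add: Cauchy_convergent_iff convergent_LIMSEQ_iff)
    qed
    have "Cauchy (\<lambda>n. f n z)"
    proof (rule metric_CauchyI)
      fix e :: real assume "e > 0"
      then obtain N where "\<forall>m\<ge>N. \<forall>n\<ge>N. \<forall>w\<in>ball z r. norm (f m w - f n w) \<le> e/2"
        using C[of "e/2"] by auto
      then have "\<forall>m\<ge>N. \<forall>n\<ge>N. norm (f m z - f n z) \<le> e/2" using r by simp
      then show "\<exists>M. \<forall>m\<ge>M. \<forall>n\<ge>M. dist (f m z) (f n z) < e"
        using \<open>e > 0\<close> unfolding dist_norm by (smt (verit) field_sum_of_halves)
    qed
    then obtain l where l: "(\<lambda>n. f n z) \<longlonglongrightarrow> l" using Cauchy_convergent_iff convergent_def by blast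
    have "\<exists>g'. \<forall>x\<in>?S. (\<lambda>n. f n x) \<longlonglongrightarrow> g' x \<and> (g' has_derivative (\<lambda>v. lim (\<lambda>n. D n x v))) (at x within ?S)"
    proof (rule has_derivative_sequence[where f'=D and ?x0.0=z and l=l])
      show "(f n has_derivative D n x) (at x within ?S)" if "x \<in> ?S" for n x
        using D(1) S that has_derivative_at_withinI by blast
      show "\<forall>\<^sub>F n in sequentially. \<forall>x\<in>?S. \<forall>h. norm (D n x h - lim (\<lambda>n. D n x h)) \<le> e * norm h" if "e > 0" for e
      proof -
        from DC[OF that] obtain N where N: "\<And>m n w v. m \<ge> N \<Longrightarrow> n \<ge> N \<Longrightarrow> w \<in> ?S \<Longrightarrow> norm (D m w v - D n w v) \<le> e * norm v"
          by blast
        have "norm (D m w v - lim (\<lambda>n. D n w v)) \<le> e * norm v" if "m \<ge> N" "w \<in> ?S" for m w v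
        proof (rule tendsto_upperbound)
          show "(\<lambda>n. norm (D m w v - D n w v)) \<longlonglongrightarrow> norm (D m w v - lim (\<lambda>n. D n w v))"
            by (intro tendsto_intros conv that)
          show "\<forall>\<^sub>F n in sequentially. norm (D m w v - D n w v) \<le> e * norm v"
            using N that unfolding eventually_sequentially by blast
        qed simp
        then show ?thesis unfolding eventually_sequentially by blast
      qed
    qed (use r l in auto)
    then obtain g' where g': "\<And>x. x \<in> ?S \<Longrightarrow> (\<lambda>n. f n x) \<longlonglongrightarrow> g' x"
      "\<And>x. x \<in> ?S \<Longrightarrow> (g' has_derivative (\<lambda>v. lim (\<lambda>n. D n x v))) (at x within ?S)" by blast
    have gg': "g x = g' x" if "x \<in> ?S" for x using g'(1)[OF that] by (simp add: g_def limI)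
    have zS: "z \<in> ?S" using r by simp
    have "(g' has_derivative (\<lambda>v. lim (\<lambda>n. D n z v))) (at z)"
      using g'(2)[OF zS] at_within_open[OF zS open_ball] by simp
    then have "(g has_derivative (\<lambda>v. lim (\<lambda>n. D n z v))) (at z)"
      by (rule has_derivative_transform_within_open[OF _ open_ball zS]) (use gg' in auto)
    moreover have "lim (\<lambda>n. D n z (c *s v)) = c * lim (\<lambda>n. D n z v)" for c v
      using tendsto_mult_left[OF conv[OF zS, of v], of c] D(2)[OF z] by (simp add: limI)
    ultimately show ?thesis using g'(1)[OF zS] gg'[OF zS] by auto
  qed
  show thesis by (rule that[of g]) (use main in \<open>auto simp: analytic_function_on_def\<close>)
qed

section \<open>The maximum principle in several variables\<close>

text \<open>The set where \<open>f\<close> is 1 is closed by continuity, and open because the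
  one-variable maximum principle makes \<open>f\<close> constant on discs in complex lines through
  any of its points; connectedness finishes.\<close>

lemma analytic_eq_1_of_norm_le_1:
  fixes f :: "complex ^ 'd \<Rightarrow> complex"
  assumes f: "analytic_function_on \<Omega> f" and "open \<Omega>" "connected \<Omega>"
    and le: "\<And>z. z \<in> \<Omega> \<Longrightarrow> norm (f z) \<le> 1" and z1: "z1 \<in> \<Omega>" "f z1 = 1" and z: "z \<in> \<Omega>"
  shows "f z = 1"
proof -
  let ?A = "{w \<in> \<Omega>. f w = 1}"
  have cont: "continuous_on \<Omega> f" by (rule analytic_function_on_imp_continuous_on[OF f])
  have "open ?A"
    unfolding open_contains_ball
  proof
    fix w assume "w \<in> ?A"
    then have w: "w \<in> \<Omega>" "f w = 1" by auto
    obtain r where r: "r > 0" "ball w r \<subseteq> \<Omega>" using \<open>open \<Omega>\<close> w open_contains_ball by blast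
    have "f y = 1" if y: "y \<in> ball w r" for y
    proof (cases "y = w")
      case False
      let ?v = "y - w"
      \<comment> \<open>\<open>R\<close> exceeds 1, so the disc contains both the parameter 0 of
        \<open>w\<close> and the parameter 1 of \<open>y\<close>.\<close>
      define R where "R = r / norm ?v"
      have R: "R > 1" using False y by (simp add: R_def dist_norm norm_minus_commute)
      have inB: "w + \<zeta> *s ?v \<in> ball w r" if "\<zeta> \<in> ball 0 R" for \<zeta>
        using that False
        by (simp only: mem_ball dist_add_vector_scalar_mult) (simp add: R_def field_simps)
      have "(\<lambda>\<zeta>. f (w + \<zeta> *s ?v)) constant_on ball 0 R"
      proof (rule maximum_modulus_principle[where U="ball 0 R" and \<xi>=0])
        show "(\<lambda>\<zeta>. f (w + \<zeta> *s ?v)) holomorphic_on ball 0 R"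
          by (rule holomorphic_on_slice[OF f]) (use inB r in blast)
        show "norm (f (w + \<zeta> *s ?v)) \<le> norm (f (w + 0 *s ?v))" if "\<zeta> \<in> ball 0 R" for \<zeta>
        proof -
          have "norm (f (w + \<zeta> *s ?v)) \<le> 1" using le inB[OF that] r by blast
          moreover have "f (w + 0 *s ?v) = 1" using w by simp
          ultimately show ?thesis by (simp only: norm_one)
        qed
      qed (use R inB r le w in \<open>auto\<close>)
      then have "f (w + 1 *s ?v) = f (w + 0 *s ?v)"
        using R unfolding constant_on_def by (metis centre_in_ball dist_0_norm less_trans mem_ball norm_one zero_less_one)
      then show ?thesis using w by simp
    qed (use w in simp)
    then show "\<exists>e>0. ball w e \<subseteq> ?A" using r by blast
  qed
  then have "openin (top_of_set \<Omega>) ?A" by (simp add: open_subset)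
  moreover have "closedin (top_of_set \<Omega>) ?A"
    using continuous_closedin_preimage_constant[OF cont, of 1] by simp
  ultimately have "?A = {} \<or> ?A = \<Omega>" using \<open>connected \<Omega>\<close> connected_clopen by blast
  then show ?thesis using z z1 by blast
qed

section \<open>Riesz representation and density in Hilbert function spaces\<close>

text \<open>Definiteness is left out because \<open>L2\<close> consists of representatives, where
  null functions have norm zero. The same rules thus serve \<open>ell2\<close>, \<open>L2\<close>,
  \<open>L2a\<close> and H(b).\<close>

locale function_pre_inner =
  fixes H :: "('a \<Rightarrow> complex) set" and ip :: "'a fun_inner"
  assumes zero_mem: "(\<lambda>x. 0) \<in> H"
    and add_mem: "f \<in> H \<Longrightarrow> g \<in> H \<Longrightarrow> (\<lambda>x. f x + g x) \<in> H"
    and scale_mem: "f \<in> H \<Longrightarrow> (\<lambda>x. c * f x) \<in> H"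
    and ip_add_left: "f \<in> H \<Longrightarrow> g \<in> H \<Longrightarrow> h \<in> H \<Longrightarrow> ip (\<lambda>x. f x + g x) h = ip f h + ip g h"
    and ip_scale_left: "f \<in> H \<Longrightarrow> g \<in> H \<Longrightarrow> ip (\<lambda>x. c * f x) g = c * ip f g"
    and ip_cnj: "f \<in> H \<Longrightarrow> g \<in> H \<Longrightarrow> ip g f = cnj (ip f g)"
    and ip_nonneg: "f \<in> H \<Longrightarrow> 0 \<le> Re (ip f f)"
begin

lemma diff_mem: "f \<in> H \<Longrightarrow> g \<in> H \<Longrightarrow> (\<lambda>x. f x - g x) \<in> H"
  using add_mem[OF _ scale_mem[of g "-1"], of f] by simp

lemma ip_add_right: "f \<in> H \<Longrightarrow> g \<in> H \<Longrightarrow> h \<in> H \<Longrightarrow> ip h (\<lambda>x. f x + g x) = ip h f + ip h g"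
  using ip_cnj[OF add_mem, of f g h] ip_cnj[of f h] ip_cnj[of g h] by (simp add: ip_add_left)

lemma ip_scale_right: "f \<in> H \<Longrightarrow> g \<in> H \<Longrightarrow> ip g (\<lambda>x. c * f x) = cnj c * ip g f"
  using ip_cnj[OF scale_mem, of f g c] ip_cnj[of f g] by (simp add: ip_scale_left)

lemma ip_diff_left: "f \<in> H \<Longrightarrow> g \<in> H \<Longrightarrow> h \<in> H \<Longrightarrow> ip (\<lambda>x. f x - g x) h = ip f h - ip g h"
  using ip_add_left[OF _ scale_mem[of g "-1"], of f h] ip_scale_left[of g h "-1"] by simp

lemma ip_diff_right: "f \<in> H \<Longrightarrow> g \<in> H \<Longrightarrow> h \<in> H \<Longrightarrow> ip h (\<lambda>x. f x - g x) = ip h f - ip h g"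
  using ip_cnj[OF diff_mem, of f g h] ip_cnj[of f h] ip_cnj[of g h] by (simp add: ip_diff_left)

lemma ip_zero_left: "h \<in> H \<Longrightarrow> ip (\<lambda>x. 0) h = 0"
  using ip_scale_left[OF zero_mem, of h 0] by simp

lemma sum_mem: "(\<And>i. i \<in> I \<Longrightarrow> \<phi> i \<in> H) \<Longrightarrow> (\<lambda>x. \<Sum>i\<in>I. c i * \<phi> i x) \<in> H"
  by (induction I rule: infinite_finite_induct) (auto intro!: zero_mem add_mem scale_mem)

lemma ip_sum_left:
  "(\<And>i. i \<in> I \<Longrightarrow> \<phi> i \<in> H) \<Longrightarrow> h \<in> H \<Longrightarrow> ip (\<lambda>x. \<Sum>i\<in>I. c i * \<phi> i x) h = (\<Sum>i\<in>I. c i * ip (\<phi> i) h)"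
proof (induction I rule: infinite_finite_induct)
  case (insert i I)
  then have "ip (\<lambda>x. c i * \<phi> i x + (\<Sum>i\<in>I. c i * \<phi> i x)) h = c i * ip (\<phi> i) h + (\<Sum>i\<in>I. c i * ip (\<phi> i) h)"
    by (subst ip_add_left) (auto intro!: scale_mem sum_mem simp: ip_scale_left)
  then show ?case using insert by simp
qed (auto simp: ip_zero_left)

lemma ip_sum_right:
  assumes "\<And>i. i \<in> I \<Longrightarrow> \<phi> i \<in> H" "h \<in> H"
  shows "ip h (\<lambda>x. \<Sum>i\<in>I. c i * \<phi> i x) = (\<Sum>i\<in>I. cnj (c i) * ip h (\<phi> i))"
proof -
  have "ip h (\<lambda>x. \<Sum>i\<in>I. c i * \<phi> i x) = cnj (ip (\<lambda>x. \<Sum>i\<in>I. c i * \<phi> i x) h)"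
    by (intro ip_cnj sum_mem assms)
  also have "\<dots> = (\<Sum>i\<in>I. cnj (c i) * cnj (ip (\<phi> i) h))"
    using assms by (simp add: ip_sum_left)
  also have "\<dots> = (\<Sum>i\<in>I. cnj (c i) * ip h (\<phi> i))"
    using ip_cnj assms by (intro sum.cong refl) metis
  finally show ?thesis .
qed

lemma ip_norm_square: "f \<in> H \<Longrightarrow> (ip_norm ip f)\<^sup>2 = Re (ip f f)"
  by (simp add: ip_norm_def ip_nonneg)

lemma ip_self: "f \<in> H \<Longrightarrow> ip f f = of_real ((ip_norm ip f)\<^sup>2)"
  using arg_cong[OF ip_cnj[of f f], of Im] by (simp add: ip_norm_square complex_eq_iff)

lemma ip_norm_nonneg: "f \<in> H \<Longrightarrow> 0 \<le> ip_norm ip f"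
  by (simp add: ip_norm_def ip_nonneg)

lemma ip_norm_scale: "f \<in> H \<Longrightarrow> ip_norm ip (\<lambda>x. c * f x) = norm c * ip_norm ip f"
proof -
  assume f: "f \<in> H"
  have "ip (\<lambda>x. c * f x) (\<lambda>x. c * f x) = (c * cnj c) * ip f f"
    by (simp only: ip_scale_left[OF f scale_mem[OF f]] ip_scale_right[OF f f] mult.assoc)
  also have "\<dots> = of_real ((norm c)\<^sup>2 * (ip_norm ip f)\<^sup>2)"
    by (simp only: complex_norm_square[symmetric] ip_self[OF f] of_real_mult)
  finally have "(ip_norm ip (\<lambda>x. c * f x))\<^sup>2 = (norm c * ip_norm ip f)\<^sup>2"
    by (simp only: ip_norm_square[OF scale_mem[OF f]] Re_complex_of_real power_mult_distrib)
  then show ?thesis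
    by (rule power2_eq_imp_eq) (simp_all add: f ip_norm_nonneg scale_mem)
qed

lemma ip_norm_add_square:
  assumes "f \<in> H" "g \<in> H"
  shows "(ip_norm ip (\<lambda>x. f x + g x))\<^sup>2 = (ip_norm ip f)\<^sup>2 + 2 * Re (ip f g) + (ip_norm ip g)\<^sup>2"
  using assms ip_cnj[of f g] by (simp add: ip_norm_square add_mem ip_add_left ip_add_right)

lemma ip_norm_diff_square:
  assumes "f \<in> H" "g \<in> H"
  shows "(ip_norm ip (\<lambda>x. f x - g x))\<^sup>2 = (ip_norm ip f)\<^sup>2 - 2 * Re (ip f g) + (ip_norm ip g)\<^sup>2"
  using assms ip_cnj[of f g] by (simp add: ip_norm_square diff_mem ip_diff_left ip_diff_right)

text \<open>The square of the norm of \<open>f - t \<langle>f, g\<rangle> g\<close> is nonnegative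
  for all real \<open>t\<close>. The form being only semidefinite, the case where \<open>g\<close>
  has norm zero needs its own argument.\<close>

lemma Cauchy_Schwarz:
  assumes "f \<in> H" "g \<in> H"
  shows "norm (ip f g) \<le> ip_norm ip f * ip_norm ip g"
proof -
  let ?p = "(norm (ip f g))\<^sup>2" and ?a = "(ip_norm ip f)\<^sup>2" and ?b = "(ip_norm ip g)\<^sup>2"
  have *: "0 \<le> ?a - 2 * t * ?p + t\<^sup>2 * ?p * ?b" for t :: real
  proof -
    have "Re (cnj (of_real t * ip f g) * ip f g) = t * ?p"
      unfolding cmod_power2 by (simp add: power2_eq_square algebra_simps)
    then have "(ip_norm ip (\<lambda>x. f x - (of_real t * ip f g) * g x))\<^sup>2 = ?a - 2 * (t * ?p) + (norm (of_real t * ip f g) * ip_norm ip g)\<^sup>2"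
      using assms by (simp add: ip_norm_diff_square scale_mem ip_scale_right ip_norm_scale del: complex_cnj_mult)
    moreover have "(norm (of_real t * ip f g) * ip_norm ip g)\<^sup>2 = t\<^sup>2 * ?p * ?b"
      by (simp add: norm_mult power_mult_distrib)
    moreover have "0 \<le> (ip_norm ip (\<lambda>x. f x - (of_real t * ip f g) * g x))\<^sup>2" by simp
    ultimately show ?thesis by simp
  qed
  have "?p \<le> ?a * ?b"
  proof (cases "?b = 0")
    case True
    have "?p = 0"
    proof (rule ccontr)
      assume "?p \<noteq> 0"
      \<comment> \<open>At this \<open>t\<close> the expression equals -1 when
        \<open>?b = 0\<close>.\<close>
      then show False using *[of "(?a + 1) / (2 * ?p)"] True by (simp add: field_simps)
    qed
    then show ?thesis by simp
  next
    case False
    then have "?b > 0" by (simp add: less_le)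
    have "0 \<le> ?a - 2 * (1/?b) * ?p + (1/?b)\<^sup>2 * ?p * ?b" by (rule *)
    also have "\<dots> = ?a - ?p / ?b" using False by (simp add: power2_eq_square field_simps)
    finally show ?thesis using \<open>?b > 0\<close> by (simp add: field_simps)
  qed
  then have "(norm (ip f g))\<^sup>2 \<le> (ip_norm ip f * ip_norm ip g)\<^sup>2" by (simp add: power_mult_distrib)
  then show ?thesis by (rule power2_le_imp_le) (use assms in \<open>simp add: ip_norm_nonneg\<close>)
qed

lemma ip_norm_triangle:
  assumes "f \<in> H" "g \<in> H"
  shows "ip_norm ip (\<lambda>x. f x + g x) \<le> ip_norm ip f + ip_norm ip g"
proof (rule power2_le_imp_le)
  have "Re (ip f g) \<le> ip_norm ip f * ip_norm ip g"
    using Cauchy_Schwarz[OF assms] complex_Re_le_cmod order_trans by blast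
  then show "(ip_norm ip (\<lambda>x. f x + g x))\<^sup>2 \<le> (ip_norm ip f + ip_norm ip g)\<^sup>2"
    using assms by (simp add: ip_norm_add_square power2_sum)
qed (use assms in \<open>simp add: ip_norm_nonneg\<close>)

lemma ip_norm_sum:
  assumes "\<And>i. i \<in> I \<Longrightarrow> \<phi> i \<in> H"
  shows "ip_norm ip (\<lambda>x. \<Sum>i\<in>I. c i * \<phi> i x) \<le> (\<Sum>i\<in>I. norm (c i) * ip_norm ip (\<phi> i))"
  using assms
proof (induction I rule: infinite_finite_induct)
  case (insert i I)
  have "ip_norm ip (\<lambda>x. c i * \<phi> i x + (\<Sum>i\<in>I. c i * \<phi> i x))
      \<le> ip_norm ip (\<lambda>x. c i * \<phi> i x) + ip_norm ip (\<lambda>x. \<Sum>i\<in>I. c i * \<phi> i x)"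
    using insert.prems by (intro ip_norm_triangle scale_mem sum_mem) auto
  then show ?case using insert by (simp add: ip_norm_scale)
qed (simp_all add: ip_norm_def ip_zero_left zero_mem)

lemma ip_norm_diff_commute:
  assumes "f \<in> H" "g \<in> H"
  shows "ip_norm ip (\<lambda>x. f x - g x) = ip_norm ip (\<lambda>x. g x - f x)"
  using ip_norm_scale[OF diff_mem[OF assms], of "-1"] by simp

lemma ip_norm_triangle_diff:
  assumes "f \<in> H" "g \<in> H" "h \<in> H"
  shows "ip_norm ip (\<lambda>x. f x - g x) \<le> ip_norm ip (\<lambda>x. f x - h x) + ip_norm ip (\<lambda>x. g x - h x)"
  using ip_norm_triangle[OF diff_mem[OF assms(1,3)] diff_mem[OF assms(3,2)]] ip_norm_diff_commute[OF assms(2,3)]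
  by simp

lemma tendsto_ip:
  assumes "\<And>n. F n \<in> H" "h \<in> H" "g \<in> H" "(\<lambda>n. ip_norm ip (\<lambda>x. F n x - h x)) \<longlonglongrightarrow> 0"
  shows "(\<lambda>n. ip (F n) g) \<longlonglongrightarrow> ip h g"
proof (rule LIM_zero_cancel, rule Lim_null_comparison)
  show "\<forall>\<^sub>F n in sequentially. norm (ip (F n) g - ip h g) \<le> ip_norm ip (\<lambda>x. F n x - h x) * ip_norm ip g"
    using Cauchy_Schwarz[OF diff_mem[OF assms(1,2)] assms(3)] assms by (simp add: ip_diff_left)
  show "(\<lambda>n. ip_norm ip (\<lambda>x. F n x - h x) * ip_norm ip g) \<longlonglongrightarrow> 0"
    using assms(4) by (rule tendsto_mult_left_zero)
qed

text \<open>A bounded functional on a subspace is given by its graph \<open>G\<close>, so that its well-definedness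
  is part of the bound; the representing vector minimises \<open>\<parallel>u\<parallel>\<^sup>2 - 2 Re l\<close> over \<open>G\<close>.\<close>
lemma Riesz_graph:
  assumes complete: "complete_inner_on H ip"
    and G0: "((\<lambda>x. 0), 0) \<in> G"
    and GH: "\<And>u l. (u, l) \<in> G \<Longrightarrow> u \<in> H"
    and Gadd: "\<And>u l u' l'. (u, l) \<in> G \<Longrightarrow> (u', l') \<in> G \<Longrightarrow> ((\<lambda>x. u x + u' x), l + l') \<in> G"
    and Gscale: "\<And>c u l. (u, l) \<in> G \<Longrightarrow> ((\<lambda>x. c * u x), c * l) \<in> G"
    and bound: "\<And>u l. (u, l) \<in> G \<Longrightarrow> norm l \<le> C * ip_norm ip u"
  obtains h where "h \<in> H" "\<And>u l. (u, l) \<in> G \<Longrightarrow> ip u h = l"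
    "\<And>e. e > 0 \<Longrightarrow> \<exists>u l. (u, l) \<in> G \<and> ip_norm ip (\<lambda>x. u x - h x) < e"
proof -
  define J where "J = (\<lambda>(u, l). (ip_norm ip u)\<^sup>2 - 2 * Re l)"
  \<comment> \<open>With \<open>x = ip_norm ip u\<close> the bound on \<open>l\<close> shows that
    \<open>J p\<close> is at least \<open>x\<^sup>2 - 2 * C * x\<close>; completing the square gives
    the claim.\<close>
  have J_lower: "- C\<^sup>2 \<le> J p" if "p \<in> G" for p
  proof -
    obtain u l where p: "p = (u, l)" by fastforce
    have "Re l \<le> C * ip_norm ip u"
      using bound[of u l] that p complex_Re_le_cmod order_trans by blast
    moreover have "0 \<le> (ip_norm ip u - C)\<^sup>2" by simp
    ultimately show ?thesis by (simp add: J_def p power2_eq_square algebra_simps)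
  qed
  define m where "m = Inf (J ` G)"
  have bdd: "bdd_below (J ` G)" using J_lower by (rule bdd_belowI2)
  have m_le: "m \<le> J p" if "p \<in> G" for p
    unfolding m_def using bdd that by (rule cINF_lower)
  have "\<exists>p\<in>G. J p < m + inverse (real (Suc n))" for n
    using cInf_lessD[of "J ` G" "m + inverse (real (Suc n))"] G0 unfolding m_def by fastforce
  then obtain s where s: "\<And>n. s n \<in> G" "\<And>n. J (s n) < m + inverse (real (Suc n))" by metis
  define U L where "U = (\<lambda>n. fst (s n))" and "L = (\<lambda>n. snd (s n))"
  have UL: "(U n, L n) \<in> G" and JU: "(ip_norm ip (U n))\<^sup>2 - 2 * Re (L n) < m + inverse (real (Suc n))" for n
    using s[of n] by (auto simp: U_def L_def J_def split: prod.splits)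
  have UH: "U n \<in> H" for n using GH UL by blast
  \<comment> \<open>Parallelogram law: the midpoint of two near-minimisers again lies in
    \<open>G\<close>, where \<open>J\<close> is at least \<open>m\<close>, so the two are close to
    each other.\<close>
  have par: "(ip_norm ip (\<lambda>x. U i x - U j x))\<^sup>2 \<le> 2 * inverse (real (Suc i)) + 2 * inverse (real (Suc j))" for i j
  proof -
    have "((\<lambda>x. (1/2) * (U i x + U j x)), (1/2) * (L i + L j)) \<in> G"
      by (intro Gscale Gadd UL)
    from m_le[OF this] have "m \<le> (ip_norm ip (\<lambda>x. U i x + U j x))\<^sup>2 / 4 - Re (L i + L j)"
      unfolding J_def prod.case ip_norm_scale[OF add_mem[OF UH UH, of i j]] by (simp add: power_divide add_divide_distrib)
    then show ?thesis
      using JU[of i] JU[of j] ip_norm_add_square[OF UH UH, of i j] ip_norm_diff_square[OF UH UH, of i j] plus_complex.sel(1)[of "L i" "L j"] by linarith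
  qed
  have "\<exists>N. \<forall>i\<ge>N. \<forall>j\<ge>N. ip_norm ip (\<lambda>x. U i x - U j x) < e" if "e > 0" for e
  proof -
    obtain N where N: "inverse (real (Suc N)) < e\<^sup>2 / 4"
      using reals_Archimedean[of "e\<^sup>2 / 4"] \<open>e > 0\<close> by auto
    have "ip_norm ip (\<lambda>x. U i x - U j x) < e" if "i \<ge> N" "j \<ge> N" for i j
    proof (rule power2_less_imp_less)
      have "inverse (real (Suc i)) \<le> inverse (real (Suc N))" "inverse (real (Suc j)) \<le> inverse (real (Suc N))"
        using that by (simp_all add: le_imp_inverse_le)
      then show "(ip_norm ip (\<lambda>x. U i x - U j x))\<^sup>2 < e\<^sup>2" using par[of i j] N by linarith
    qed (use \<open>e > 0\<close> in simp)
    then show ?thesis by blast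
  qed
  then obtain h where h: "h \<in> H" "(\<lambda>n. ip_norm ip (\<lambda>x. U n x - h x)) \<longlonglongrightarrow> 0"
    using complete[unfolded complete_inner_on_def, THEN spec, of U] UH by blast
  have "ip v h = l" if vl: "(v, l) \<in> G" for v l
  proof -
    have vH: "v \<in> H" using GH vl by blast
    define w where "w = ip v h - l"
    \<comment> \<open>Perturbing \<open>U n\<close> by \<open>t * v\<close> cannot bring
      \<open>J\<close> below \<open>m\<close>; in the limit only the terms of first and second order
      in \<open>t\<close> remain.\<close>
    have pos: "0 \<le> 2 * Re (t * w) + (norm t)\<^sup>2 * (ip_norm ip v)\<^sup>2" for t
    proof (rule tendsto_lowerbound)
      let ?q = "\<lambda>n. inverse (real (Suc n)) + 2 * Re (t * (cnj (ip (U n) v) - l)) + (norm t)\<^sup>2 * (ip_norm ip v)\<^sup>2"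
      have A: "(\<lambda>n. cnj (ip (U n) v)) \<longlonglongrightarrow> ip v h"
        unfolding ip_cnj[OF h(1) vH] by (intro tendsto_cnj tendsto_ip UH h vH)
      have "?q \<longlonglongrightarrow> 0 + 2 * Re (t * (ip v h - l)) + (norm t)\<^sup>2 * (ip_norm ip v)\<^sup>2"
        by (intro tendsto_add tendsto_mult tendsto_const tendsto_Re tendsto_diff A LIMSEQ_inverse_real_of_nat)
      then show "?q \<longlonglongrightarrow> 2 * Re (t * w) + (norm t)\<^sup>2 * (ip_norm ip v)\<^sup>2"
        by (simp add: w_def)
      have "0 \<le> ?q n" for n
      proof -
        have "m \<le> J ((\<lambda>x. U n x + t * v x), L n + t * l)"
          by (intro m_le Gadd Gscale UL vl)
        also have "\<dots> = (ip_norm ip (U n))\<^sup>2 + 2 * Re (cnj t * ip (U n) v) + (norm t * ip_norm ip v)\<^sup>2 - 2 * Re (L n + t * l)"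
          unfolding J_def prod.case ip_norm_add_square[OF UH scale_mem[OF vH]]
            ip_scale_right[OF vH UH] ip_norm_scale[OF vH] ..
        finally have "m \<le> (ip_norm ip (U n))\<^sup>2 + 2 * Re (cnj t * ip (U n) v) + (norm t)\<^sup>2 * (ip_norm ip v)\<^sup>2
            - 2 * Re (L n) - 2 * Re (t * l)"
          by (simp only: power_mult_distrib plus_complex.sel distrib_left diff_diff_add)
        moreover have "Re (cnj t * ip (U n) v) = Re (t * cnj (ip (U n) v))" by simp
        moreover have "Re (t * (cnj (ip (U n) v) - l)) = Re (t * cnj (ip (U n) v)) - Re (t * l)"
          by (simp only: right_diff_distrib minus_complex.sel)
        ultimately show ?thesis using JU[of n] by linarith
      qed
      then show "\<forall>\<^sub>F n in sequentially. 0 \<le> ?q n" by simp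
    qed simp
    define a where "a = (ip_norm ip v)\<^sup>2"
    \<comment> \<open>At \<open>t = - r cnj w\<close> the inequality reads
      \<open>0 \<le> r (norm w)\<^sup>2 (r a - 2)\<close>. Since \<open>r a < 1\<close> the last
      factor is negative; the added 1 also admits \<open>a = 0\<close>.\<close>
    define r where "r = 1 / (a + 1)"
    have "a \<ge> 0" by (simp add: a_def)
    then have r: "r > 0" "r * a < 1" by (simp_all add: r_def)
    have "Re (- (of_real r * cnj w) * w) = - r * (norm w)\<^sup>2"
      unfolding cmod_power2 by (simp add: power2_eq_square algebra_simps)
    moreover have "(norm (- (of_real r * cnj w)))\<^sup>2 = r\<^sup>2 * (norm w)\<^sup>2"
      by (simp add: norm_mult power_mult_distrib)
    ultimately have "0 \<le> 2 * (- r * (norm w)\<^sup>2) + r\<^sup>2 * (norm w)\<^sup>2 * a"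
      using pos[of "- (of_real r * cnj w)"] by (simp only: a_def)
    also have "\<dots> = r * (norm w)\<^sup>2 * (r * a - 2)" by (simp add: power2_eq_square algebra_simps)
    finally have "0 \<le> r * (norm w)\<^sup>2 * (r * a - 2)" .
    moreover have "r * a - 2 < 0" using r by simp
    ultimately have "r * (norm w)\<^sup>2 \<le> 0" by (metis mult_pos_neg not_le)
    then have "w = 0" using r by (simp add: mult_le_0_iff)
    then show ?thesis by (simp add: w_def)
  qed
  moreover have "\<exists>u l. (u, l) \<in> G \<and> ip_norm ip (\<lambda>x. u x - h x) < e" if "e > 0" for e
  proof -
    have "\<forall>\<^sub>F n in sequentially. ip_norm ip (\<lambda>x. U n x - h x) < e"
      using order_tendstoD(2)[OF h(2) that] .
    then show ?thesis using UL unfolding eventually_sequentially by blast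
  qed
  ultimately show thesis using that h(1) by blast
qed

text \<open>Representing \<open>v \<mapsto> ip v f\<close> on \<open>S\<close> gives a vector in the
  closure of \<open>S\<close>, which plays the part of the orthogonal projection of
  \<open>f\<close>: its difference from \<open>f\<close> is orthogonal to \<open>S\<close>.\<close>

lemma dense_if_orthogonal_trivial:
  assumes complete: "complete_inner_on H ip"
    and SH: "S \<subseteq> H" and S0: "(\<lambda>x. 0) \<in> S"
    and Sadd: "\<And>f g. f \<in> S \<Longrightarrow> g \<in> S \<Longrightarrow> (\<lambda>x. f x + g x) \<in> S"
    and Sscale: "\<And>c f. f \<in> S \<Longrightarrow> (\<lambda>x. c * f x) \<in> S"
    and orth: "\<And>u. u \<in> H \<Longrightarrow> (\<And>v. v \<in> S \<Longrightarrow> ip v u = 0) \<Longrightarrow> u = (\<lambda>x. 0)"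
  shows "dense_in_space S H ip"
  unfolding dense_in_space_def
proof (intro conjI SH ballI allI impI)
  fix f e assume f: "f \<in> H" and e: "(e::real) > 0"
  have SH': "v \<in> H" if "v \<in> S" for v using SH that by blast
  let ?G = "{(v, ip v f) | v. v \<in> S}"
  obtain h where h: "h \<in> H" "\<And>u l. (u, l) \<in> ?G \<Longrightarrow> ip u h = l"
    "\<And>e. e > 0 \<Longrightarrow> \<exists>u l. (u, l) \<in> ?G \<and> ip_norm ip (\<lambda>x. u x - h x) < e"
  proof (rule Riesz_graph[OF complete, of ?G "ip_norm ip f"])
    fix u l u' l' assume "(u, l) \<in> ?G" "(u', l') \<in> ?G"
    then have "u \<in> S" "l = ip u f" "u' \<in> S" "l' = ip u' f" by auto
    then show "((\<lambda>x. u x + u' x), l + l') \<in> ?G"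
      using SH' f Sadd[of u u'] ip_add_left[of u u' f] by auto
  next
    fix c u l assume "(u, l) \<in> ?G"
    then have "u \<in> S" "l = ip u f" by auto
    then show "((\<lambda>x. c * u x), c * l) \<in> ?G"
      using SH' f Sscale[of u c] ip_scale_left[of u f c] by auto
  next
    fix u l assume "(u, l) \<in> ?G"
    then show "norm l \<le> ip_norm ip f * ip_norm ip u" 
      using SH' f Cauchy_Schwarz[of u f] by (auto simp: mult.commute)
  qed (use S0 SH' f ip_zero_left in auto)
  have "(\<lambda>x. f x - h x) = (\<lambda>x. 0)"
  proof (rule orth)
    fix v assume "v \<in> S"
    then show "ip v (\<lambda>x. f x - h x) = 0"
      using h(2)[of v "ip v f"] SH f h(1) by (auto simp: ip_diff_right)
  qed (rule diff_mem[OF f h(1)])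
  then have "f = h" by (metis eq_iff_diff_eq_0 ext)
  obtain u where "u \<in> S" "ip_norm ip (\<lambda>x. u x - h x) < e" using h(3)[OF e] by blast
  then show "\<exists>g\<in>S. ip_norm ip (\<lambda>x. f x - g x) < e"
    using \<open>f = h\<close> ip_norm_diff_commute[OF SH' f, of u] by auto
qed

end

lemma hilbert_function_space_pre_inner:
  assumes "hilbert_function_space X H ip"
  shows "function_pre_inner H ip"
proof -
  have "function_subspace X H" "complex_inner_on H ip"
    using assms unfolding hilbert_function_space_def by auto
  then show ?thesis
    unfolding function_subspace_def complex_inner_on_def by unfold_locales metis+
qed

text \<open>Restores the definiteness that \<open>function_pre_inner\<close> omits.\<close>

lemma ip_norm_eq_0_imp:
  assumes "hilbert_function_space X H ip" "f \<in> H" "ip_norm ip f = 0"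
  shows "f = (\<lambda>x. 0)"
proof -
  interpret function_pre_inner H ip by (rule hilbert_function_space_pre_inner[OF assms(1)])
  have "ip f f = 0" using ip_self[OF assms(2)] assms(3) by simp
  then show ?thesis
    using assms(1,2) unfolding hilbert_function_space_def complex_inner_on_def by blast
qed

section \<open>Linear spans\<close>

lemma function_span_add:
  assumes "f \<in> function_span S" "g \<in> function_span S"
  shows "(\<lambda>x. f x + g x) \<in> function_span S"
proof -
  obtain c F where f: "f = (\<lambda>x. \<Sum>h\<in>F. c h * h x)" "finite F" "F \<subseteq> S"
    using assms(1) unfolding function_span_def by blast
  obtain d G where g: "g = (\<lambda>x. \<Sum>h\<in>G. d h * h x)" "finite G" "G \<subseteq> S"
    using assms(2) unfolding function_span_def by blast
  \<comment> \<open>Coefficients default to 0 outside their own index set, so that both sums run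
    over the union and common members have their coefficients added.\<close>
  let ?c = "\<lambda>h. (if h \<in> F then c h else 0) + (if h \<in> G then d h else 0)"
  have "(\<Sum>h\<in>F. c h * h x) + (\<Sum>h\<in>G. d h * h x) = (\<Sum>h\<in>F \<union> G. ?c h * h x)" for x
  proof -
    have "(\<Sum>h\<in>F. c h * h x) = (\<Sum>h\<in>F \<union> G. (if h \<in> F then c h else 0) * h x)"
      by (rule sum.mono_neutral_cong_left) (use f g in auto)
    moreover have "(\<Sum>h\<in>G. d h * h x) = (\<Sum>h\<in>F \<union> G. (if h \<in> G then d h else 0) * h x)"
      by (rule sum.mono_neutral_cong_left) (use f g in auto)
    ultimately show ?thesis by (simp add: distrib_right sum.distrib)
  qed
  then show ?thesis unfolding function_span_def using f g
    by (intro CollectI exI[of _ ?c] exI[of _ "F \<union> G"]) auto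
qed

lemma function_span_scale:
  assumes "f \<in> function_span S"
  shows "(\<lambda>x. a * f x) \<in> function_span S"
proof -
  obtain c F where f: "f = (\<lambda>x. \<Sum>h\<in>F. c h * h x)" "finite F" "F \<subseteq> S"
    using assms(1) unfolding function_span_def by blast
  then show ?thesis unfolding function_span_def
    by (intro CollectI exI[of _ "\<lambda>h. a * c h"] exI[of _ F]) (auto simp: sum_distrib_left mult_ac)
qed

lemma function_span_superset: "f \<in> S \<Longrightarrow> f \<in> function_span S"
  unfolding function_span_def by (intro CollectI exI[of _ "\<lambda>_. 1"] exI[of _ "{f}"]) auto

lemma function_span_zero: "(\<lambda>x. 0) \<in> function_span S"
  unfolding function_span_def by (intro CollectI exI[of _ "\<lambda>_. 1"] exI[of _ "{}"]) auto

section \<open>Row-contractions and square-integrable functions\<close>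

lemma norm_mult_cnj_le: "norm (z * cnj w) \<le> (norm z)\<^sup>2 + (norm w)\<^sup>2"
proof -
  have "2 * norm z * norm w \<le> (norm z)\<^sup>2 + (norm w)\<^sup>2" by (rule sum_squares_bound)
  moreover have "0 \<le> norm z * norm w" by simp
  ultimately show ?thesis unfolding norm_mult complex_mod_cnj by linarith
qed

lemma norm_add_square_le:
  fixes z w :: complex
  shows "(norm (z + w))\<^sup>2 \<le> 2 * (norm z)\<^sup>2 + 2 * (norm w)\<^sup>2"
proof -
  have "(norm (z + w))\<^sup>2 \<le> (norm z + norm w)\<^sup>2" by (intro power_mono norm_triangle_ineq) simp
  then show ?thesis using sum_squares_bound[of "norm z" "norm w"] unfolding power2_sum by linarith
qed

section \<open>The space \<open>ell2\<close> and analytic maps into it\<close>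

lemma summable_ell2_mult:
  assumes "x \<in> ell2" "y \<in> ell2"
  shows "summable (\<lambda>n. x n * cnj (y n))"
proof (rule summable_comparison_test')
  show "summable (\<lambda>n. (norm (x n))\<^sup>2 + (norm (y n))\<^sup>2)"
    using assms by (auto simp: ell2_def intro: summable_add)
  show "norm (x n * cnj (y n)) \<le> (norm (x n))\<^sup>2 + (norm (y n))\<^sup>2" for n
    by (rule norm_mult_cnj_le)
qed

lemma ell2_pre_inner: "function_pre_inner ell2 ell2_inner"
proof -
  note sm = summable_ell2_mult
  have add: "(\<lambda>n. x n + y n) \<in> ell2" if "x \<in> ell2" "y \<in> ell2" for x y
    unfolding ell2_def
  proof (rule CollectI, rule summable_comparison_test')
    show "summable (\<lambda>n. 2 * (norm (x n))\<^sup>2 + 2 * (norm (y n))\<^sup>2)"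
      using that by (auto simp: ell2_def intro!: summable_add summable_mult)
    show "norm ((norm (x n + y n))\<^sup>2) \<le> 2 * (norm (x n))\<^sup>2 + 2 * (norm (y n))\<^sup>2" for n
      using norm_add_square_le by simp
  qed
  show ?thesis
  proof
    show "(\<lambda>n. c * x n) \<in> ell2" if "x \<in> ell2" for x c
      using that summable_mult[of "\<lambda>n. (norm (x n))\<^sup>2" "(norm c)\<^sup>2"] by (simp add: ell2_def norm_mult power_mult_distrib)
    show "ell2_inner (\<lambda>n. x n + y n) z = ell2_inner x z + ell2_inner y z" if "x \<in> ell2" "y \<in> ell2" "z \<in> ell2" for x y z
      using that by (simp add: ell2_inner_def distrib_right suminf_add sm)
    show "ell2_inner (\<lambda>n. c * x n) y = c * ell2_inner x y" if "x \<in> ell2" "y \<in> ell2" for x y c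
      using suminf_mult[OF sm[OF that], of c] by (simp add: ell2_inner_def mult.assoc)
    show "ell2_inner y x = cnj (ell2_inner x y)" if "x \<in> ell2" "y \<in> ell2" for x y
    proof -
      have "(\<lambda>n. cnj (x n * cnj (y n))) sums cnj (ell2_inner x y)"
        unfolding ell2_inner_def by (rule sums_cnj[THEN iffD2, OF summable_sums[OF sm[OF that]]])
      then show ?thesis by (simp add: ell2_inner_def sums_iff mult.commute)
    qed
    show "0 \<le> Re (ell2_inner x x)" if "x \<in> ell2" for x
    proof -
      have "0 \<le> (\<Sum>n. Re (x n * cnj (x n)))"
        by (rule suminf_nonneg[OF summable_Re[OF sm[OF that that]]]) simp
      then show ?thesis unfolding ell2_inner_def Re_suminf[OF sm[OF that that]] .
    qed
  qed (use add in \<open>auto simp: ell2_def\<close>)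
qed

interpretation ell2: function_pre_inner ell2 ell2_inner by (rule ell2_pre_inner)

lemma ip_norm_ell2_inner: "x \<in> ell2 \<Longrightarrow> ip_norm ell2_inner x = ell2_norm x"
proof -
  assume "x \<in> ell2"
  then have "(\<lambda>n. of_real ((norm (x n))\<^sup>2) :: complex) sums of_real (\<Sum>n. (norm (x n))\<^sup>2)"
    by (intro sums_of_real summable_sums) (simp add: ell2_def)
  then have "ell2_inner x x = of_real (\<Sum>n. (norm (x n))\<^sup>2)"
    unfolding ell2_inner_def complex_norm_square by (simp add: sums_iff)
  then show ?thesis by (simp add: ip_norm_def ell2_norm_def)
qed

text \<open>Names the remainder of the derivative and places it in \<open>ell2\<close>, with its
  norm taken from the inner product, so that the Cauchy-Schwarz and triangle inequalities
  apply.\<close>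

lemma ell2_analytic_on_derivative:
  fixes b :: "complex ^ 'd \<Rightarrow> nat \<Rightarrow> complex"
  assumes "ell2_analytic_on \<Omega> b" "open \<Omega>" "z \<in> \<Omega>"
  obtains a r where "\<And>j. a j \<in> ell2"
    "\<And>w. w \<in> \<Omega> \<Longrightarrow> r w \<in> ell2"
    "\<And>w :: complex ^ 'd. r w = (\<lambda>n. b w n - b z n - (\<Sum>j\<in>UNIV. (w - z) $ j * a j n))"
    "((\<lambda>w. ip_norm ell2_inner (r w) / norm (w - z)) \<longlongrightarrow> 0) (at z)"
proof -
  have bm: "b w \<in> ell2" if "w \<in> \<Omega>" for w using assms that unfolding ell2_analytic_on_def by blast
  obtain a where a: "\<And>j. a j \<in> ell2" and
    l: "((\<lambda>w. ell2_norm (\<lambda>n. b w n - b z n - (\<Sum>j\<in>UNIV. (w - z) $ j * a j n)) / norm (w - z)) \<longlongrightarrow> 0) (at z)"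
    using assms unfolding ell2_analytic_on_def by meson
  define r where "r = (\<lambda>w n. b w n - b z n - (\<Sum>j\<in>UNIV. (w - z) $ j * a j n))"
  have rm: "r w \<in> ell2" if "w \<in> \<Omega>" for w
    unfolding r_def by (intro ell2.diff_mem ell2.sum_mem bm a that assms)
  have ev: "\<forall>\<^sub>F w in at z. w \<in> \<Omega>"
    using assms(2,3) by (rule eventually_at_in_open')
  have "((\<lambda>w. ip_norm ell2_inner (r w) / norm (w - z)) \<longlongrightarrow> 0) (at z)"
  proof (rule Lim_transform_eventually[OF l])
    show "\<forall>\<^sub>F w in at z. ell2_norm (\<lambda>n. b w n - b z n - (\<Sum>j\<in>UNIV. (w - z) $ j * a j n)) / norm (w - z)
        = ip_norm ell2_inner (r w) / norm (w - z)"
      using ev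
    proof eventually_elim
      case (elim w)
      show ?case using ip_norm_ell2_inner[OF rm[OF elim]] unfolding r_def by (simp only:)
    qed
  qed
  with a rm r_def show thesis by (intro that) auto
qed

text \<open>Pairing with a fixed \<open>y\<close> is a bounded complex-linear functional, so it
  carries the derivative in the norm of \<open>ell2\<close> to a scalar one; Cauchy-Schwarz controls
  the remainder.\<close>

lemma analytic_ell2_inner:
  fixes b :: "complex ^ 'd \<Rightarrow> nat \<Rightarrow> complex"
  assumes b: "ell2_analytic_on \<Omega> b" and "open \<Omega>" and y: "y \<in> ell2"
  shows "analytic_function_on \<Omega> (\<lambda>w. ell2_inner (b w) y)"
  unfolding analytic_function_on_def
proof
  fix z assume z: "z \<in> \<Omega>"
  have bm: "b w \<in> ell2" if "w \<in> \<Omega>" for w using b that unfolding ell2_analytic_on_def by blast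
  obtain a r where a: "\<And>j. a j \<in> ell2" and rm: "\<And>w. w \<in> \<Omega> \<Longrightarrow> r w \<in> ell2"
    and r: "\<And>w. r w = (\<lambda>n. b w n - b z n - (\<Sum>j\<in>UNIV. (w - z) $ j * a j n))"
    and lim: "((\<lambda>w. ip_norm ell2_inner (r w) / norm (w - z)) \<longlongrightarrow> 0) (at z)"
    by (rule ell2_analytic_on_derivative[OF b assms(2) z]) (rule that, assumption+)
  define D where "D = (\<lambda>v :: complex ^ 'd. \<Sum>j\<in>UNIV. v $ j * ell2_inner (a j) y)"
  have "((\<lambda>w. ell2_inner (b w) y) has_derivative D) (at z)"
    unfolding has_derivative_iff_norm
  proof
    show "bounded_linear D" unfolding D_def
      by (intro bounded_linear_sum bounded_linear_mult_const bounded_linear_vec_nth)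
    show "((\<lambda>w. norm (ell2_inner (b w) y - ell2_inner (b z) y - D (w - z)) / norm (w - z)) \<longlongrightarrow> 0) (at z)"
    proof (rule Lim_null_comparison)
      show "((\<lambda>w. ip_norm ell2_inner (r w) / norm (w - z) * ip_norm ell2_inner y) \<longlongrightarrow> 0) (at z)"
        using lim by (rule tendsto_mult_left_zero)
      have ev: "\<forall>\<^sub>F w in at z. w \<in> \<Omega>"
        using assms(2) z by (rule eventually_at_in_open')
      then show "\<forall>\<^sub>F w in at z. norm (norm (ell2_inner (b w) y - ell2_inner (b z) y - D (w - z)) / norm (w - z))
          \<le> ip_norm ell2_inner (r w) / norm (w - z) * ip_norm ell2_inner y"
      proof eventually_elim
        case (elim w)
        have "ell2_inner (r w) y = ell2_inner (b w) y - ell2_inner (b z) y - D (w - z)"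
          unfolding r D_def
          by (simp add: ell2.ip_diff_left ell2.ip_sum_left ell2.diff_mem ell2.sum_mem bm a y z elim)
        then show ?case
          using ell2.Cauchy_Schwarz[OF rm[OF elim] y] by (simp add: divide_right_mono)
      qed
    qed
  qed
  moreover have "D (c *s v) = c * D v" for c v
    by (simp add: D_def sum_distrib_left mult.assoc)
  ultimately show "\<exists>D. ((\<lambda>w. ell2_inner (b w) y) has_derivative D) (at z) \<and> (\<forall>c v. D (c *s v) = c * D v)"
    by blast
qed

text \<open>A component is the pairing with a unit vector.\<close>

lemma analytic_ell2_component:
  assumes "ell2_analytic_on \<Omega> b" "open \<Omega>"
  shows "analytic_function_on \<Omega> (\<lambda>w. b w n)"
proof -
  have "(\<lambda>i. if i = n then 1 else 0) \<in> ell2"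
    unfolding ell2_def by (auto intro!: summable_finite[of "{n}"] split: if_splits)
  moreover have "ell2_inner x (\<lambda>i. if i = n then 1 else 0) = x n" for x
    unfolding ell2_inner_def by (subst suminf_finite[of "{n}"]) auto
  ultimately show ?thesis using analytic_ell2_inner[OF assms] by fastforce
qed

text \<open>Differentiability in norm implies continuity in norm, which the reverse triangle
  inequality passes on to the norm itself. On compact sets this will keep
  \<open>\<parallel>b\<parallel>\<close> away from 1.\<close>

lemma continuous_on_ell2_norm:
  fixes b :: "complex ^ 'd \<Rightarrow> nat \<Rightarrow> complex"
  assumes b: "ell2_analytic_on \<Omega> b" and "open \<Omega>"
  shows "continuous_on \<Omega> (\<lambda>w. ell2_norm (b w))"
proof (rule continuous_at_imp_continuous_on, rule ballI)
  fix z assume z: "z \<in> \<Omega>"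
  have bm: "b w \<in> ell2" if "w \<in> \<Omega>" for w using b that unfolding ell2_analytic_on_def by blast
  obtain a r where a: "\<And>j. a j \<in> ell2" and rm: "\<And>w. w \<in> \<Omega> \<Longrightarrow> r w \<in> ell2"
    and r: "\<And>w. r w = (\<lambda>n. b w n - b z n - (\<Sum>j\<in>UNIV. (w - z) $ j * a j n))"
    and lim: "((\<lambda>w. ip_norm ell2_inner (r w) / norm (w - z)) \<longlongrightarrow> 0) (at z)"
    by (rule ell2_analytic_on_derivative[OF b assms(2) z]) (rule that, assumption+)
  let ?N = "ip_norm ell2_inner"
  \<comment> \<open>For \<open>w \<noteq> z\<close> the first summand is the norm of
    \<open>r w\<close>, written as a quotient times \<open>norm (w - z)\<close> so that the limit of
    the quotient can be used.\<close>
  let ?B = "\<lambda>w. ?N (r w) / norm (w - z) * norm (w - z) + (\<Sum>j\<in>UNIV. norm ((w - z) $ j) * ?N (a j))"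
  have "isCont (\<lambda>w. ell2_norm (b w)) z \<longleftrightarrow> ((\<lambda>w. ell2_norm (b w)) \<longlongrightarrow> ell2_norm (b z)) (at z)"
    by (rule isCont_def)
  moreover have "((\<lambda>w. ell2_norm (b w)) \<longlongrightarrow> ell2_norm (b z)) (at z)"
  proof (rule LIM_zero_cancel, rule Lim_null_comparison)
    have id: "((\<lambda>w. w - z) \<longlongrightarrow> z - z) (at z)" by (intro tendsto_intros)
    have "(?B \<longlongrightarrow> 0 * norm (z - z) + (\<Sum>j\<in>UNIV. norm ((z - z) $ j) * ?N (a j))) (at z)"
      by (intro tendsto_add tendsto_mult lim tendsto_norm id tendsto_sum tendsto_const tendsto_vec_nth)
    then show "(?B \<longlongrightarrow> 0) (at z)" by simp
    have ev: "\<forall>\<^sub>F w in at z. w \<in> \<Omega> \<and> w \<noteq> z"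
      using eventually_at_in_open'[OF assms(2) z] eventually_neq_at_within[of z z] by eventually_elim auto
    then show "\<forall>\<^sub>F w in at z. norm (ell2_norm (b w) - ell2_norm (b z)) \<le> ?B w"
    proof eventually_elim
      case (elim w)
      let ?s = "\<lambda>n. \<Sum>j\<in>UNIV. (w - z) $ j * a j n"
      have s: "?s \<in> ell2" by (intro ell2.sum_mem a)
      have "(\<lambda>n. b w n - b z n) = (\<lambda>n. r w n + ?s n)" by (simp add: r)
      then have "?N (\<lambda>n. b w n - b z n) \<le> ?N (r w) + ?N ?s"
        using ell2.ip_norm_triangle[OF rm s] elim by simp
      also have "?N ?s \<le> (\<Sum>j\<in>UNIV. norm ((w - z) $ j) * ?N (a j))"
        by (rule ell2.ip_norm_sum) (rule a)
      finally have le: "?N (\<lambda>n. b w n - b z n) \<le> ?B w" using elim by simp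
      have "?N (b w) \<le> ?N (b z) + ?N (\<lambda>n. b w n - b z n)"
        using ell2.ip_norm_triangle[OF bm[OF z] ell2.diff_mem[OF bm bm[OF z]], of w] elim by simp
      moreover have "?N (b z) \<le> ?N (b w) + ?N (\<lambda>n. b w n - b z n)"
        using ell2.ip_norm_triangle[OF bm ell2.diff_mem[OF bm[OF z] bm], of w w]
          ell2.ip_norm_diff_commute[OF bm[OF z] bm, of w] elim by simp
      ultimately show ?case using le bm elim z by (simp add: ip_norm_ell2_inner abs_le_iff)
    qed
  qed
  ultimately show "isCont (\<lambda>w. ell2_norm (b w)) z" by blast
qed

text \<open>If \<open>\<parallel>b(z)\<parallel> = 1\<close>, the maximum principle makes \<open>w \<mapsto> \<langle>b(w), b(z)\<rangle>\<close> constantly \<open>1\<close>.\<close>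
lemma analytic_row_contraction_norm_less_1:
  fixes b :: "complex ^ 'd \<Rightarrow> nat \<Rightarrow> complex"
  assumes b: "analytic_row_contraction \<Omega> b" and "domain_in_Cd \<Omega>"
    and z0: "z0 \<in> \<Omega>" "ell2_norm (b z0) < 1" and z: "z \<in> \<Omega>"
  shows "ell2_norm (b z) < 1"
proof (rule ccontr)
  assume "\<not> ell2_norm (b z) < 1"
  have an: "ell2_analytic_on \<Omega> b" and le: "\<And>w. w \<in> \<Omega> \<Longrightarrow> ell2_norm (b w) \<le> 1"
    using b unfolding analytic_row_contraction_def by auto
  have \<Omega>: "open \<Omega>" "connected \<Omega>" using assms(2) unfolding domain_in_Cd_def by auto
  have bm: "b w \<in> ell2" if "w \<in> \<Omega>" for w using an that unfolding ell2_analytic_on_def by blast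
  have nz: "ell2_norm (b z) = 1" using le[OF z] \<open>\<not> _\<close> by simp
  have CS: "norm (ell2_inner (b w) (b z)) \<le> ell2_norm (b w)" if "w \<in> \<Omega>" for w
    using ell2.Cauchy_Schwarz[OF bm[OF that] bm[OF z]] that z nz by (simp add: ip_norm_ell2_inner bm)
  \<comment> \<open>The value 1 at \<open>z0\<close> will contradict \<open>CS\<close>, since the
    norm of \<open>b z0\<close> is below 1.\<close>
  have "ell2_inner (b z0) (b z) = 1"
  proof (rule analytic_eq_1_of_norm_le_1[OF analytic_ell2_inner[OF an \<Omega>(1) bm[OF z]] \<Omega> _ z _ z0(1)])
    show "norm (ell2_inner (b w) (b z)) \<le> 1" if "w \<in> \<Omega>" for w using CS[OF that] le[OF that] by simp
    show "ell2_inner (b z) (b z) = 1" using ell2.ip_self[OF bm[OF z]] nz bm[OF z] by (simp add: ip_norm_ell2_inner)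
  qed
  then show False using CS[OF z0(1)] z0(2) by simp
qed

section \<open>Algebra of analytic and of square-integrable functions\<close>

lemma analytic_function_on_const: "analytic_function_on \<Omega> (\<lambda>z. c)"
  unfolding analytic_function_on_def by (auto intro!: exI[of _ "\<lambda>_. 0"])

lemma analytic_function_on_add:
  assumes "analytic_function_on \<Omega> f" "analytic_function_on \<Omega> g"
  shows "analytic_function_on \<Omega> (\<lambda>z. f z + g z)"
  unfolding analytic_function_on_def
proof
  fix z assume "z \<in> \<Omega>"
  then obtain D E where "(f has_derivative D) (at z)" "\<forall>c v. D (c *s v) = c * D v"
    "(g has_derivative E) (at z)" "\<forall>c v. E (c *s v) = c * E v"
    using assms unfolding analytic_function_on_def by meson
  then show "\<exists>D. ((\<lambda>z. f z + g z) has_derivative D) (at z) \<and> (\<forall>c v. D (c *s v) = c * D v)"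
    by (intro exI[of _ "\<lambda>v. D v + E v"]) (auto intro: has_derivative_add simp: distrib_left)
qed

lemma analytic_function_on_mult:
  assumes "analytic_function_on \<Omega> f" "analytic_function_on \<Omega> g"
  shows "analytic_function_on \<Omega> (\<lambda>z. f z * g z)"
  unfolding analytic_function_on_def
proof
  fix z assume "z \<in> \<Omega>"
  then obtain D E where "(f has_derivative D) (at z)" "\<forall>c v. D (c *s v) = c * D v"
    "(g has_derivative E) (at z)" "\<forall>c v. E (c *s v) = c * E v"
    using assms unfolding analytic_function_on_def by meson
  then show "\<exists>D. ((\<lambda>z. f z * g z) has_derivative D) (at z) \<and> (\<forall>c v. D (c *s v) = c * D v)"
    by (intro exI[of _ "\<lambda>v. f z * E v + D v * g z"] conjI has_derivative_mult) (auto simp: algebra_simps)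
qed

lemma analytic_function_on_cong:
  assumes "open \<Omega>" "\<And>z. z \<in> \<Omega> \<Longrightarrow> f z = g z" "analytic_function_on \<Omega> f"
  shows "analytic_function_on \<Omega> g"
  unfolding analytic_function_on_def
proof
  fix z assume z: "z \<in> \<Omega>"
  then obtain D where D: "(f has_derivative D) (at z)" "\<forall>c v. D (c *s v) = c * D v"
    using assms(3) unfolding analytic_function_on_def by meson
  have "(g has_derivative D) (at z)"
    by (rule has_derivative_transform_within_open[OF D(1) assms(1) z assms(2)])
  with D(2) show "\<exists>D. (g has_derivative D) (at z) \<and> (\<forall>c v. D (c *s v) = c * D v)" by blast
qed

lemma L2_mult_bounded:
  assumes "f \<in> L2 M" "g \<in> borel_measurable M" "\<And>x. x \<in> space M \<Longrightarrow> norm (g x) \<le> 1"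
  shows "(\<lambda>x. g x * f x) \<in> L2 M"
proof -
  have [measurable]: "f \<in> borel_measurable M" "g \<in> borel_measurable M" using assms by (auto simp: L2_def)
  have "integrable M (\<lambda>x. (norm (g x * f x))\<^sup>2)"
  proof (rule Bochner_Integration.integrable_bound)
    show "integrable M (\<lambda>x. (norm (f x))\<^sup>2)" using assms by (simp add: L2_def)
    have "norm (g x * f x) \<le> norm (f x)" if "x \<in> space M" for x
      using mult_right_mono[OF assms(3)[OF that] norm_ge_zero[of "f x"]] by (simp add: norm_mult)
    then show "AE x in M. norm ((norm (g x * f x))\<^sup>2) \<le> norm ((norm (f x))\<^sup>2)"
      by (intro AE_I2) (simp add: power_mono)
  qed simp
  then show ?thesis by (simp add: L2_def)
qed

lemma L2_pre_inner: "function_pre_inner (L2 M) (L2_inner M)"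
proof -
  have int: "integrable M (\<lambda>x. f x * cnj (g x))" if "f \<in> L2 M" "g \<in> L2 M" for f g
  proof (rule Bochner_Integration.integrable_bound)
    show "integrable M (\<lambda>x. (norm (f x))\<^sup>2 + (norm (g x))\<^sup>2)"
      using that by (simp add: L2_def)
    have "norm (f x * cnj (g x)) \<le> (norm (f x))\<^sup>2 + (norm (g x))\<^sup>2" for x
      by (rule norm_mult_cnj_le)
    then show "AE x in M. norm (f x * cnj (g x)) \<le> norm ((norm (f x))\<^sup>2 + (norm (g x))\<^sup>2)" by simp
    have [measurable]: "f \<in> borel_measurable M" "g \<in> borel_measurable M" using that by (auto simp: L2_def)
    have [measurable]: "cnj \<in> borel \<rightarrow>\<^sub>M borel"
      by (intro borel_measurable_continuous_onI continuous_intros)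
    show "(\<lambda>x. f x * cnj (g x)) \<in> borel_measurable M" by measurable
  qed
  have add: "(\<lambda>x. f x + g x) \<in> L2 M" if "f \<in> L2 M" "g \<in> L2 M" for f g
  proof -
    have [measurable]: "f \<in> borel_measurable M" "g \<in> borel_measurable M" using that by (auto simp: L2_def)
    have "integrable M (\<lambda>x. (norm (f x + g x))\<^sup>2)"
    proof (rule Bochner_Integration.integrable_bound)
      show "integrable M (\<lambda>x. 2 * (norm (f x))\<^sup>2 + 2 * (norm (g x))\<^sup>2)"
        using that by (simp add: L2_def)
      have "(norm (f x + g x))\<^sup>2 \<le> 2 * (norm (f x))\<^sup>2 + 2 * (norm (g x))\<^sup>2" for x
        by (rule norm_add_square_le)
      then show "AE x in M. norm ((norm (f x + g x))\<^sup>2) \<le> norm (2 * (norm (f x))\<^sup>2 + 2 * (norm (g x))\<^sup>2)" by simp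
    qed simp
    then show ?thesis by (simp add: L2_def)
  qed
  show ?thesis
  proof
    show "(\<lambda>x. c * f x) \<in> L2 M" if "f \<in> L2 M" for f c
      using that by (auto simp: L2_def norm_mult power_mult_distrib intro: borel_measurable_times)
    show "L2_inner M (\<lambda>x. f x + g x) h = L2_inner M f h + L2_inner M g h"
      if "f \<in> L2 M" "g \<in> L2 M" "h \<in> L2 M" for f g h
      using that by (simp add: L2_inner_def distrib_right int)
    show "L2_inner M (\<lambda>x. c * f x) g = c * L2_inner M f g" if "f \<in> L2 M" "g \<in> L2 M" for f g c
      by (simp add: L2_inner_def mult.assoc)
    show "L2_inner M g f = cnj (L2_inner M f g)" if "f \<in> L2 M" "g \<in> L2 M" for f g
      using Bochner_Integration.integral_cnj[of M "\<lambda>x. f x * cnj (g x)"] by (simp add: L2_inner_def mult.commute)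
    show "0 \<le> Re (L2_inner M f f)" if "f \<in> L2 M" for f
      using int[OF that that] by (simp add: L2_inner_def flip: integral_Re)
  qed (use add in \<open>auto simp: L2_def\<close>)
qed

text \<open>Translates Hilbert space norms into extended nonnegative integrals, where termwise
  integration of series and Fatou's lemma apply directly.\<close>

lemma nn_integral_L2_norm:
  assumes "f \<in> L2 M"
  shows "(\<integral>\<^sup>+x. ennreal ((norm (f x))\<^sup>2) \<partial>M) = ennreal ((ip_norm (L2_inner M) f)\<^sup>2)"
proof -
  interpret function_pre_inner "L2 M" "L2_inner M" by (rule L2_pre_inner)
  have int: "integrable M (\<lambda>x. (norm (f x))\<^sup>2)" using assms by (simp add: L2_def)
  have "(\<integral>\<^sup>+x. ennreal ((norm (f x))\<^sup>2) \<partial>M) = ennreal (\<integral>x. (norm (f x))\<^sup>2 \<partial>M)"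
    by (rule nn_integral_eq_integral[OF int]) simp
  moreover have "L2_inner M f f = of_real (\<integral>x. (norm (f x))\<^sup>2 \<partial>M)"
    unfolding L2_inner_def complex_norm_square[symmetric] by (rule integral_of_real[OF int])
  ultimately show ?thesis using assms by (simp add: ip_norm_square)
qed

section \<open>Finite combinations of kernels\<close>

text \<open>Coefficient families are the data, so that one \<open>c\<close> produces both a
  combination of the kernels \<open>k\<close> and its image in H(b) without a map between spans
  having to be well defined. An infinite support, where the sum would default to 0, is excluded by
  \<open>coeffs_on\<close>.\<close>

definition lincomb :: "('a \<Rightarrow> complex) \<Rightarrow> ('a \<Rightarrow> 'b \<Rightarrow> complex) \<Rightarrow> 'b \<Rightarrow> complex" where
  "lincomb c \<phi> = (\<lambda>z. \<Sum>x | c x \<noteq> 0. c x * \<phi> x z)"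

definition coeffs_on :: "'a set \<Rightarrow> ('a \<Rightarrow> complex) set" where
  "coeffs_on X = {c. finite {x. c x \<noteq> 0} \<and> {x. c x \<noteq> 0} \<subseteq> X}"

text \<open>Lets families with different supports be summed over a common finite index set.\<close>

lemma lincomb_superset:
  assumes "finite F" "{x. c x \<noteq> 0} \<subseteq> F"
  shows "lincomb c \<phi> z = (\<Sum>x\<in>F. c x * \<phi> x z)"
  unfolding lincomb_def by (rule sum.mono_neutral_left) (use assms in auto)

lemma coeffs_on_add:
  assumes "c \<in> coeffs_on X" "d \<in> coeffs_on X"
  shows "(\<lambda>x. c x + d x) \<in> coeffs_on X"
proof -
  have "{x. c x + d x \<noteq> 0} \<subseteq> {x. c x \<noteq> 0} \<union> {x. d x \<noteq> 0}" by auto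
  moreover have "finite ({x. c x \<noteq> 0} \<union> {x. d x \<noteq> 0})" "{x. c x \<noteq> 0} \<union> {x. d x \<noteq> 0} \<subseteq> X"
    using assms by (simp_all add: coeffs_on_def)
  ultimately show ?thesis unfolding coeffs_on_def by (blast intro: finite_subset)
qed

lemma coeffs_on_diff:
  assumes "c \<in> coeffs_on X" "d \<in> coeffs_on X"
  shows "(\<lambda>x. c x - d x) \<in> coeffs_on X"
proof -
  have "{x. c x - d x \<noteq> 0} \<subseteq> {x. c x \<noteq> 0} \<union> {x. d x \<noteq> 0}" by auto
  moreover have "finite ({x. c x \<noteq> 0} \<union> {x. d x \<noteq> 0})" "{x. c x \<noteq> 0} \<union> {x. d x \<noteq> 0} \<subseteq> X"
    using assms by (simp_all add: coeffs_on_def)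
  ultimately show ?thesis unfolding coeffs_on_def by (blast intro: finite_subset)
qed

lemma coeffs_on_mult: "c \<in> coeffs_on X \<Longrightarrow> (\<lambda>x. c x * d x) \<in> coeffs_on X"
  by (auto simp: coeffs_on_def intro: finite_subset[of _ "{x. c x \<noteq> 0}"])

lemma coeffs_on_scale: "c \<in> coeffs_on X \<Longrightarrow> (\<lambda>x. a * c x) \<in> coeffs_on X"
  by (auto simp: coeffs_on_def intro: finite_subset[of _ "{x. c x \<noteq> 0}"])

lemma coeffs_on_zero: "(\<lambda>x. 0) \<in> coeffs_on X"
  by (simp add: coeffs_on_def)

lemma lincomb_zero: "lincomb (\<lambda>x. 0) \<phi> = (\<lambda>z. 0)"
  by (simp add: lincomb_def)

lemma lincomb_add:
  assumes "c \<in> coeffs_on X" "d \<in> coeffs_on X"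
  shows "lincomb (\<lambda>x. c x + d x) \<phi> z = lincomb c \<phi> z + lincomb d \<phi> z"
proof -
  let ?F = "{x. c x \<noteq> 0} \<union> {x. d x \<noteq> 0}"
  have F: "finite ?F" using assms by (simp add: coeffs_on_def)
  show ?thesis
    by (subst (1 2 3) lincomb_superset[OF F]) (auto simp: distrib_right sum.distrib)
qed

lemma lincomb_diff:
  assumes "c \<in> coeffs_on X" "d \<in> coeffs_on X"
  shows "lincomb (\<lambda>x. c x - d x) \<phi> z = lincomb c \<phi> z - lincomb d \<phi> z"
proof -
  let ?F = "{x. c x \<noteq> 0} \<union> {x. d x \<noteq> 0}"
  have F: "finite ?F" using assms by (simp add: coeffs_on_def)
  show ?thesis
    by (subst (1 2 3) lincomb_superset[OF F]) (auto simp: left_diff_distrib sum_subtractf)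
qed

lemma lincomb_scale:
  assumes "c \<in> coeffs_on X"
  shows "lincomb (\<lambda>x. a * c x) \<phi> z = a * lincomb c \<phi> z"
proof -
  have F: "finite {x. c x \<noteq> 0}" using assms by (simp add: coeffs_on_def)
  show ?thesis
    by (subst (1 2) lincomb_superset[OF F]) (auto simp: sum_distrib_left mult.assoc)
qed

lemma lincomb_single: "lincomb (\<lambda>y. if y = x then 1 else 0) \<phi> = \<phi> x"
  by (rule ext, subst lincomb_superset[of "{x}"]) auto

lemma (in function_pre_inner) lincomb_mem:
  assumes "c \<in> coeffs_on X" "\<And>x. x \<in> X \<Longrightarrow> \<phi> x \<in> H"
  shows "lincomb c \<phi> \<in> H"
  unfolding lincomb_def by (rule sum_mem) (use assms in \<open>auto simp: coeffs_on_def\<close>)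

lemma (in function_pre_inner) ip_lincomb_left:
  assumes "c \<in> coeffs_on X" "\<And>x. x \<in> X \<Longrightarrow> \<phi> x \<in> H" "h \<in> H"
    "finite F" "{x. c x \<noteq> 0} \<subseteq> F" "F \<subseteq> X"
  shows "ip (lincomb c \<phi>) h = (\<Sum>x\<in>F. c x * ip (\<phi> x) h)"
proof -
  have "lincomb c \<phi> = (\<lambda>z. \<Sum>x\<in>F. c x * \<phi> x z)"
    by (rule ext) (rule lincomb_superset[OF assms(4,5)])
  then show ?thesis using assms by (auto simp: ip_sum_left subset_iff)
qed

lemma (in function_pre_inner) ip_lincomb_right:
  assumes "c \<in> coeffs_on X" "\<And>x. x \<in> X \<Longrightarrow> \<phi> x \<in> H" "h \<in> H"
    "finite F" "{x. c x \<noteq> 0} \<subseteq> F" "F \<subseteq> X"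
  shows "ip h (lincomb c \<phi>) = (\<Sum>x\<in>F. cnj (c x) * ip h (\<phi> x))"
proof -
  have "lincomb c \<phi> = (\<lambda>z. \<Sum>x\<in>F. c x * \<phi> x z)"
    by (rule ext) (rule lincomb_superset[OF assms(4,5)])
  then show ?thesis using assms by (auto simp: ip_sum_right subset_iff)
qed

section \<open>Comparison with Lebesgue measure\<close>

text \<open>The inequality for sets becomes one for integrals because the integral is monotone in
  the measure; both measures are first restricted to \<open>K\<close> and so acquire the same
  measurable sets.\<close>

lemma nn_integral_dominates_lebesgue:
  fixes \<Omega> :: "(complex ^ 'd) set"
  assumes sets: "sets \<mu> = sets (restrict_space borel \<Omega>)" and \<Omega>: "\<Omega> \<in> sets borel"
    and dom: "dominates_lebesgue_locally \<Omega> \<mu>" and K: "compact K" "K \<subseteq> \<Omega>"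
  obtains c :: real where "c > 0" "\<And>u. u \<in> borel_measurable borel \<Longrightarrow>
    ennreal c * (\<integral>\<^sup>+x. u x * indicator K x \<partial>lborel) \<le> (\<integral>\<^sup>+x. u x * indicator K x \<partial>\<mu>)"
proof -
  have "\<exists>c::real. c > 0 \<and> (\<forall>E\<in>sets borel. E \<subseteq> K \<longrightarrow> ennreal c * emeasure lborel E \<le> emeasure \<mu> E)"
    using dom[unfolded dominates_lebesgue_locally_def, THEN spec, of K] K by simp
  then obtain c :: real where c: "c > 0"
    and le: "\<And>E. E \<in> sets borel \<Longrightarrow> E \<subseteq> K \<Longrightarrow> ennreal c * emeasure lborel E \<le> emeasure \<mu> E"
    by (elim exE conjE) (rule that, assumption, drule bspec, assumption, drule mp, assumption+)
  have sp: "space \<mu> = \<Omega>" using sets_eq_imp_space_eq[OF sets] by (simp add: space_restrict_space)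
  have Kb [measurable]: "K \<in> sets borel" by (intro borel_closed compact_imp_closed K)
  have setsiff: "A \<in> sets \<mu> \<longleftrightarrow> A \<in> sets borel \<and> A \<subseteq> \<Omega>" for A
    unfolding sets using \<Omega> by (auto simp: sets_restrict_space_iff)
  have KM: "K \<in> sets \<mu>" using Kb K setsiff by blast
  have KM': "K \<inter> space \<mu> \<in> sets \<mu>" using KM K sp by (simp add: Int_absorb2)
  let ?N1 = "scale_measure (ennreal c) (restrict_space lborel K)" and ?N2 = "restrict_space \<mu> K"
  have s12: "sets ?N1 = sets ?N2"
  proof (rule set_eqI)
    fix A show "A \<in> sets ?N1 \<longleftrightarrow> A \<in> sets ?N2"
      using K KM' Kb sp by (auto simp: sets_restrict_space_iff setsiff)
  qed
  have le12: "?N1 \<le> ?N2"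
  proof (rule less_eq_measure.intros(3))
    show "space ?N1 = space ?N2" using s12 by (rule sets_eq_imp_space_eq)
    show "emeasure ?N1 \<le> emeasure ?N2"
    proof (rule le_funI)
      fix A show "emeasure ?N1 A \<le> emeasure ?N2 A"
      proof (cases "A \<in> sets ?N1")
        case True
        then have A: "A \<in> sets borel" "A \<subseteq> K" using Kb by (auto simp: sets_restrict_space_iff)
        then show ?thesis using le[OF A] Kb KM K sp by (auto simp: emeasure_restrict_space)
      next
        case False
        then show ?thesis by (simp add: emeasure_notin_sets del: emeasure_scale_measure)
      qed
    qed
  qed (rule s12)
  show thesis
  proof (rule that[OF c])
    fix u :: "complex ^ 'd \<Rightarrow> ennreal" assume [measurable]: "u \<in> borel_measurable borel"
    have "ennreal c * (\<integral>\<^sup>+x. u x * indicator K x \<partial>lborel) = ennreal c * (\<integral>\<^sup>+x. u x \<partial>restrict_space lborel K)"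
      using Kb by (subst nn_integral_restrict_space) auto
    also have "\<dots> = (\<integral>\<^sup>+x. u x \<partial>?N1)"
      by (rule nn_integral_scale_measure[symmetric]) (auto intro: measurable_restrict_space1)
    also have "\<dots> \<le> (\<integral>\<^sup>+x. u x \<partial>?N2)" by (rule nn_integral_mono_measure[OF s12 le12])
    also have "\<dots> = (\<integral>\<^sup>+x. u x * indicator K x \<partial>\<mu>)"
      using KM K sp by (subst nn_integral_restrict_space) (auto simp: Int_absorb2)
    finally show "ennreal c * (\<integral>\<^sup>+x. u x * indicator K x \<partial>lborel) \<le> (\<integral>\<^sup>+x. u x * indicator K x \<partial>\<mu>)" .
  qed
qed

section \<open>Toeplitz and Hankel parts\<close>

text \<open>The setting after the maximum principle: \<open>b_less_1\<close> is the strict bound at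
  every point, which the final theorem derives from the single point \<open>z0\<close>.\<close>

locale bergman_row_contraction =
  fixes \<Omega> :: "(complex ^ 'd) set"
    and \<mu> :: "(complex ^ 'd) measure"
    and k :: "complex ^ 'd \<Rightarrow> complex ^ 'd \<Rightarrow> complex"
    and b :: "complex ^ 'd \<Rightarrow> nat \<Rightarrow> complex"
    and Hb :: "(complex ^ 'd \<Rightarrow> complex) set"
    and ipb :: "(complex ^ 'd) fun_inner"
  assumes open_\<Omega>: "open \<Omega>"
    and sets_\<mu>: "sets \<mu> = sets (restrict_space borel \<Omega>)"
    and kernel_k: "reproducing_kernel \<Omega> (L2a \<Omega> \<mu>) (L2_inner \<mu>) k"
    and dominates: "dominates_lebesgue_locally \<Omega> \<mu>"
    and analytic_b: "ell2_analytic_on \<Omega> b"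
    and b_less_1: "z \<in> \<Omega> \<Longrightarrow> ell2_norm (b z) < 1"
    and Hb: "hilbert_function_space \<Omega> Hb ipb"
    and kernel_b: "reproducing_kernel \<Omega> Hb ipb (row_contraction_kernel k b)"
begin

abbreviation "K \<equiv> kernel_at \<Omega> k"
abbreviation "KB \<equiv> kernel_at \<Omega> (row_contraction_kernel k b)"
abbreviation "A \<equiv> L2a \<Omega> \<mu>"
abbreviation "ipm \<equiv> L2_inner \<mu>"
abbreviation "fcoeffs \<equiv> coeffs_on \<Omega>"

sublocale L: function_pre_inner "L2 \<mu>" ipm by (rule L2_pre_inner)
sublocale B: function_pre_inner Hb ipb by (rule hilbert_function_space_pre_inner[OF Hb])

lemma space_\<mu>: "space \<mu> = \<Omega>"
  using sets_eq_imp_space_eq[OF sets_\<mu>] by (simp add: space_restrict_space)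

lemma b_mem: "z \<in> \<Omega> \<Longrightarrow> b z \<in> ell2"
  using analytic_b unfolding ell2_analytic_on_def by blast

lemma A_imp_L2: "f \<in> A \<Longrightarrow> f \<in> L2 \<mu>" by (simp add: L2a_def)
lemma A_imp_analytic: "f \<in> A \<Longrightarrow> analytic_function_on \<Omega> f" by (simp add: L2a_def)
lemma A_imp_functions_on: "f \<in> A \<Longrightarrow> f \<in> functions_on \<Omega>" by (simp add: L2a_def)

sublocale A: function_pre_inner A ipm
proof
  show "(\<lambda>x. c * f x) \<in> A" if "f \<in> A" for f c
    using that L.scale_mem analytic_function_on_mult[OF analytic_function_on_const[of \<Omega> c]]
    by (auto simp: L2a_def functions_on_def)
  show "(\<lambda>x. f x + g x) \<in> A" if "f \<in> A" "g \<in> A" for f g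
    using that L.add_mem analytic_function_on_add by (auto simp: L2a_def functions_on_def)
  show "(\<lambda>x. 0) \<in> A"
    using L.zero_mem analytic_function_on_const[of \<Omega> 0] by (auto simp: L2a_def functions_on_def)
qed (auto dest!: A_imp_L2 intro: L.ip_add_left L.ip_scale_left L.ip_cnj L.ip_nonneg)

lemma K_mem: "x \<in> \<Omega> \<Longrightarrow> K x \<in> A"
  using kernel_k unfolding reproducing_kernel_def by blast

lemma ip_K: "f \<in> A \<Longrightarrow> x \<in> \<Omega> \<Longrightarrow> ipm f (K x) = f x"
  using kernel_k unfolding reproducing_kernel_def by simp

lemma KB_mem: "x \<in> \<Omega> \<Longrightarrow> KB x \<in> Hb"
  using kernel_b unfolding reproducing_kernel_def by blast

lemma ip_KB: "f \<in> Hb \<Longrightarrow> x \<in> \<Omega> \<Longrightarrow> ipb f (KB x) = f x"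
  using kernel_b unfolding reproducing_kernel_def by simp

lemma k_cnj: "x \<in> \<Omega> \<Longrightarrow> y \<in> \<Omega> \<Longrightarrow> k x y = cnj (k y x)"
  using A.ip_cnj[OF K_mem K_mem, of x y] ip_K[OF K_mem, of x y] ip_K[OF K_mem, of y x]
  by (simp add: kernel_at_def)

lemma borel_measurable_\<mu>: "continuous_on \<Omega> f \<Longrightarrow> f \<in> borel_measurable \<mu>"
  using borel_measurable_continuous_on_restrict measurable_cong_sets[OF sets_\<mu> refl] by blast

lemma norm_b_le_1: "z \<in> \<Omega> \<Longrightarrow> norm (b z j) \<le> 1"
proof -
  assume z: "z \<in> \<Omega>"
  have "(norm (b z j))\<^sup>2 \<le> (\<Sum>n. (norm (b z n))\<^sup>2)"
    using b_mem[OF z] sum_le_suminf[of "\<lambda>n. (norm (b z n))\<^sup>2" "{j}"] by (simp add: ell2_def)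
  then have "norm (b z j) \<le> ell2_norm (b z)"
    unfolding ell2_norm_def by (rule real_le_rsqrt)
  then show ?thesis using b_less_1[OF z] by simp
qed

lemma analytic_b_component: "analytic_function_on \<Omega> (\<lambda>z. b z j)"
  by (rule analytic_ell2_component[OF analytic_b open_\<Omega>])

lemma measurable_b [measurable]: "(\<lambda>z. b z j) \<in> borel_measurable \<mu>"
  by (intro borel_measurable_\<mu> analytic_function_on_imp_continuous_on analytic_b_component)

lemma measurable_cnj_b: "(\<lambda>z. cnj (b z j)) \<in> borel_measurable \<mu>"
  by (intro borel_measurable_\<mu> continuous_on_cnj analytic_function_on_imp_continuous_on analytic_b_component)

lemma b_mult_mem: "f \<in> A \<Longrightarrow> (\<lambda>z. b z j * f z) \<in> A"
  using L2_mult_bounded[of f \<mu> "\<lambda>z. b z j"] analytic_function_on_mult[OF analytic_b_component[of j], of f]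
  by (auto simp: L2a_def functions_on_def norm_b_le_1 space_\<mu>)

text \<open>Conjugation destroys analyticity, so the product is placed in \<open>L2\<close> only;
  for kernel combinations \<open>Toep\<close> and \<open>Hank\<close> will be its parts in
  \<open>A\<close> and orthogonal to \<open>A\<close>.\<close>

lemma cnj_b_mult_mem: "f \<in> A \<Longrightarrow> (\<lambda>z. cnj (b z j) * f z) \<in> L2 \<mu>"
  by (rule L2_mult_bounded) (auto simp: A_imp_L2 measurable_cnj_b norm_b_le_1 space_\<mu>)

text \<open>Since \<open>T\<^sup>* k\<^sub>x\<close> has the entries \<open>cnj (b x j) k\<^sub>x\<close>, \<open>Toep c j\<close> is the \<open>j\<close>-th entry of \<open>T\<^sup>* f\<close>, that is, the
  projection of \<open>cnj b\<^sub>j f\<close> to \<open>L\<^sup>2\<^sub>a(\<mu>)\<close>.\<close>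
definition "Toep c j = lincomb (\<lambda>x. c x * cnj (b x j)) K" for c j
definition "Hank c j = (\<lambda>z. cnj (b z j) * lincomb c K z - Toep c j z)" for c j

lemma lincomb_K_mem: "c \<in> fcoeffs \<Longrightarrow> lincomb c K \<in> A"
  by (rule A.lincomb_mem) (auto intro: K_mem)

lemma Toep_mem: "c \<in> fcoeffs \<Longrightarrow> Toep c j \<in> A"
  unfolding Toep_def by (intro lincomb_K_mem coeffs_on_mult)

lemma Hank_mem: "c \<in> fcoeffs \<Longrightarrow> Hank c j \<in> L2 \<mu>"
  unfolding Hank_def by (intro L.diff_mem cnj_b_mult_mem lincomb_K_mem A_imp_L2 Toep_mem)

lemma lincomb_KB_mem: "c \<in> fcoeffs \<Longrightarrow> lincomb c KB \<in> Hb"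
  by (rule B.lincomb_mem) (auto intro: KB_mem)

lemma Toep_diff:
  assumes "c \<in> fcoeffs" "d \<in> fcoeffs"
  shows "Toep (\<lambda>x. c x - d x) j z = Toep c j z - Toep d j z"
  using lincomb_diff[OF coeffs_on_mult[OF assms(1)] coeffs_on_mult[OF assms(2)], of "\<lambda>x. cnj (b x j)" "\<lambda>x. cnj (b x j)" K z]
  by (simp add: Toep_def left_diff_distrib)

lemma Hank_diff:
  assumes "c \<in> fcoeffs" "d \<in> fcoeffs"
  shows "Hank (\<lambda>x. c x - d x) j z = Hank c j z - Hank d j z"
  using assms by (simp add: Hank_def Toep_diff lincomb_diff[of _ \<Omega>] right_diff_distrib)

section \<open>Gram sums and the orthogonal splitting\<close>

lemma ip_lincomb_K:
  assumes "c \<in> fcoeffs" "f \<in> A" "finite S" "{x. c x \<noteq> 0} \<subseteq> S" "S \<subseteq> \<Omega>"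
  shows "ipm f (lincomb c K) = (\<Sum>x\<in>S. cnj (c x) * f x)"
  using A.ip_lincomb_right[OF assms(1) K_mem assms(2-5)] assms by (auto simp: ip_K subset_iff intro!: sum.cong)

text \<open>By the reproducing property \<open>ipm (K x) (K y) = k y x\<close>, hence the order of
  the arguments.\<close>

lemma ip_lincomb_K_self:
  assumes "c \<in> fcoeffs" "finite S" "{x. c x \<noteq> 0} \<subseteq> S" "S \<subseteq> \<Omega>"
  shows "ipm (lincomb c K) (lincomb c K) = (\<Sum>x\<in>S. \<Sum>y\<in>S. c x * cnj (c y) * k y x)"
proof -
  have *: "ipm (K x) (lincomb c K) = (\<Sum>y\<in>S. cnj (c y) * k y x)" if "x \<in> S" for x
  proof -
    have "ipm (K x) (lincomb c K) = (\<Sum>y\<in>S. cnj (c y) * K x y)"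
      using that assms(4) by (intro ip_lincomb_K[OF assms(1) K_mem assms(2-4)]) auto
    also have "\<dots> = (\<Sum>y\<in>S. cnj (c y) * k y x)"
      using assms(4) by (intro sum.cong refl) (auto simp: kernel_at_def)
    finally show ?thesis .
  qed
  have "ipm (lincomb c K) (lincomb c K) = (\<Sum>x\<in>S. c x * ipm (K x) (lincomb c K))"
    by (rule A.ip_lincomb_left[OF assms(1) K_mem lincomb_K_mem[OF assms(1)] assms(2-4)])
  also have "\<dots> = (\<Sum>x\<in>S. c x * (\<Sum>y\<in>S. cnj (c y) * k y x))"
    by (simp add: *)
  finally show ?thesis by (simp add: sum_distrib_left mult.assoc)
qed

lemma ip_lincomb_KB_self:
  assumes "c \<in> fcoeffs" "finite S" "{x. c x \<noteq> 0} \<subseteq> S" "S \<subseteq> \<Omega>"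
  shows "ipb (lincomb c KB) (lincomb c KB) = (\<Sum>x\<in>S. \<Sum>y\<in>S. c x * cnj (c y) * row_contraction_kernel k b y x)"
proof -
  have *: "ipb (KB x) (lincomb c KB) = (\<Sum>y\<in>S. cnj (c y) * row_contraction_kernel k b y x)" if "x \<in> S" for x
  proof -
    have "ipb (KB x) (lincomb c KB) = (\<Sum>y\<in>S. cnj (c y) * ipb (KB x) (KB y))"
      using that assms(4) by (intro B.ip_lincomb_right[OF assms(1) KB_mem KB_mem assms(2-4)]) auto
    also have "\<dots> = (\<Sum>y\<in>S. cnj (c y) * row_contraction_kernel k b y x)"
    proof (intro sum.cong refl)
      fix y assume "y \<in> S"
      then have "ipb (KB x) (KB y) = KB x y" using that assms(4) by (intro ip_KB KB_mem) auto
      then show "cnj (c y) * ipb (KB x) (KB y) = cnj (c y) * row_contraction_kernel k b y x"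
        using \<open>y \<in> S\<close> assms(4) by (auto simp: kernel_at_def)
    qed
    finally show ?thesis .
  qed
  have "ipb (lincomb c KB) (lincomb c KB) = (\<Sum>x\<in>S. c x * ipb (KB x) (lincomb c KB))"
    by (rule B.ip_lincomb_left[OF assms(1) KB_mem lincomb_KB_mem[OF assms(1)] assms(2-4)])
  also have "\<dots> = (\<Sum>x\<in>S. c x * (\<Sum>y\<in>S. cnj (c y) * row_contraction_kernel k b y x))"
    by (simp add: *)
  finally show ?thesis by (simp add: sum_distrib_left mult.assoc)
qed

text \<open>The Gram sum of \<open>Toep c j\<close> has weights \<open>b y j * cnj (b x j)\<close>,
  and summing over \<open>j\<close> produces \<open>ell2_inner (b y) (b x)\<close>. This is the
  difference of the Gram sums for \<open>k\<close> and for the kernel of H(b); the sums over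
  \<open>x\<close> and \<open>y\<close> are finite, so they commute with the series.\<close>

lemma norm_Toep_sums:
  assumes c: "c \<in> fcoeffs"
  shows "(\<lambda>j. (ip_norm ipm (Toep c j))\<^sup>2) sums ((ip_norm ipm (lincomb c K))\<^sup>2 - (ip_norm ipb (lincomb c KB))\<^sup>2)"
proof -
  let ?S = "{x. c x \<noteq> 0}"
  have S: "finite ?S" "?S \<subseteq> \<Omega>" using c by (auto simp: coeffs_on_def)
  have bb: "(\<lambda>j. b y j * cnj (b x j)) sums ell2_inner (b y) (b x)" if "x \<in> ?S" "y \<in> ?S" for x y
  proof -
    have "summable (\<lambda>j. b y j * cnj (b x j))"
      using summable_ell2_mult[OF b_mem b_mem] that S by blast
    then show ?thesis unfolding ell2_inner_def by (rule summable_sums)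
  qed
  have T: "ipm (Toep c j) (Toep c j) = (\<Sum>x\<in>?S. \<Sum>y\<in>?S. c x * cnj (c y) * k y x * (b y j * cnj (b x j)))" for j
    unfolding Toep_def
    by (subst ip_lincomb_K_self[OF coeffs_on_mult[OF c] S(1) _ S(2)]) (auto simp: mult_ac)
  have "(\<lambda>j. ipm (Toep c j) (Toep c j)) sums (\<Sum>x\<in>?S. \<Sum>y\<in>?S. c x * cnj (c y) * k y x * ell2_inner (b y) (b x))"
    unfolding T by (intro sums_sum sums_mult bb)
  also have "(\<Sum>x\<in>?S. \<Sum>y\<in>?S. c x * cnj (c y) * k y x * ell2_inner (b y) (b x)) =
      ipm (lincomb c K) (lincomb c K) - ipb (lincomb c KB) (lincomb c KB)"
    unfolding ip_lincomb_K_self[OF c S(1) subset_refl S(2)] ip_lincomb_KB_self[OF c S(1) subset_refl S(2)]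
    by (simp add: row_contraction_kernel_def sum_subtractf[symmetric] algebra_simps)
  finally have "(\<lambda>j. Re (ipm (Toep c j) (Toep c j))) sums Re (ipm (lincomb c K) (lincomb c K) - ipb (lincomb c KB) (lincomb c KB))"
    by (rule sums_Re)
  then show ?thesis
    using c by (simp add: A.ip_norm_square B.ip_norm_square lincomb_K_mem Toep_mem lincomb_KB_mem)
qed

text \<open>Moving \<open>cnj (b z j)\<close> to the other side gives \<open>b z j * f z\<close>,
  which lies in \<open>A\<close>; the reproducing property then evaluates the inner products of
  \<open>f\<close> with the product and with \<open>Toep\<close> to the same finite sum.\<close>

lemma Hank_orthogonal:
  assumes c: "c \<in> fcoeffs" and f: "f \<in> A"
  shows "ipm f (Hank c j) = 0"
proof -
  let ?S = "{x. c x \<noteq> 0}"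
  have S: "finite ?S" "?S \<subseteq> \<Omega>" using c by (auto simp: coeffs_on_def)
  have "ipm f (\<lambda>z. cnj (b z j) * lincomb c K z) = ipm (\<lambda>z. b z j * f z) (lincomb c K)"
    by (simp add: L2_inner_def mult_ac)
  also have "\<dots> = (\<Sum>x\<in>?S. cnj (c x) * (b x j * f x))"
    by (rule ip_lincomb_K[OF c b_mult_mem[OF f] S(1) subset_refl S(2)])
  also have "\<dots> = ipm f (Toep c j)"
    unfolding Toep_def
    by (subst ip_lincomb_K[OF coeffs_on_mult[OF c] f S(1) _ S(2)]) (auto simp: mult_ac)
  finally show ?thesis
    unfolding Hank_def
    by (subst L.ip_diff_right) (auto intro: cnj_b_mult_mem lincomb_K_mem A_imp_L2 Toep_mem c f)
qed

text \<open>Pythagoras for the parts in \<open>A\<close> and orthogonal to \<open>A\<close>.\<close>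

lemma norm_cnj_b_F:
  assumes c: "c \<in> fcoeffs"
  shows "(ip_norm ipm (\<lambda>z. cnj (b z j) * lincomb c K z))\<^sup>2 = (ip_norm ipm (Toep c j))\<^sup>2 + (ip_norm ipm (Hank c j))\<^sup>2"
proof -
  have "(\<lambda>z. cnj (b z j) * lincomb c K z) = (\<lambda>z. Toep c j z + Hank c j z)"
    by (simp add: Hank_def)
  then show ?thesis
    using L.ip_norm_add_square[OF A_imp_L2[OF Toep_mem[OF c]] Hank_mem[OF c], of j j] Hank_orthogonal[OF c Toep_mem[OF c], of j j]
    by simp
qed

text \<open>With \<open>P\<close> the projection to \<open>L\<^sup>2\<^sub>a(\<mu>)\<close>, this is \<open>1 - TT\<^sup>* = P(1 - \<parallel>b\<parallel>\<^sup>2) + H\<^sup>*H\<close>.\<close>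
lemma norm_lincomb_KB_eq:
  assumes c: "c \<in> fcoeffs"
  shows "ennreal ((ip_norm ipb (lincomb c KB))\<^sup>2) =
    (\<integral>\<^sup>+z. ennreal ((1 - (ell2_norm (b z))\<^sup>2) * (norm (lincomb c K z))\<^sup>2) \<partial>\<mu>)
     + (\<Sum>j. \<integral>\<^sup>+z. ennreal ((norm (Hank c j z))\<^sup>2) \<partial>\<mu>)"
    (is "?Q = ?I + ?H")
proof -
  let ?f = "lincomb c K"
  let ?a = "(ip_norm ipm ?f)\<^sup>2" and ?q = "(ip_norm ipb (lincomb c KB))\<^sup>2"
  have [measurable]: "?f \<in> borel_measurable \<mu>" using A_imp_L2[OF lincomb_K_mem[OF c]] by (simp add: L2_def)
  have mn [measurable]: "(\<lambda>z. ell2_norm (b z)) \<in> borel_measurable \<mu>"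
    by (intro borel_measurable_\<mu> continuous_on_ell2_norm analytic_b open_\<Omega>)
  have n2: "(ell2_norm (b z))\<^sup>2 = (\<Sum>j. (norm (b z j))\<^sup>2)" if "z \<in> \<Omega>" for z
    using b_mem[OF that] by (simp add: ell2_norm_def ell2_def suminf_nonneg)
  have pos: "0 \<le> 1 - (ell2_norm (b z))\<^sup>2" if "z \<in> \<Omega>" for z
  proof -
    have "0 \<le> ell2_norm (b z)" using b_mem[OF that] by (simp add: ell2_norm_def ell2_def suminf_nonneg)
    then show ?thesis using b_less_1[OF that] by (simp add: power_le_one)
  qed
  define s where "s = (\<lambda>j. (ip_norm ipm (Toep c j))\<^sup>2)"
  have s: "s sums (?a - ?q)" unfolding s_def by (rule norm_Toep_sums[OF c])
  have s_nonneg: "0 \<le> s j" for j by (simp add: s_def)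
  \<comment> \<open>Pointwise, \<open>\<parallel>b\<parallel>\<^sup>2 |f|\<^sup>2\<close> is the
    series of the squares of the entries \<open>cnj b\<^sub>j f\<close>.\<close>
  have split: "ennreal ((norm (?f z))\<^sup>2) = ennreal ((1 - (ell2_norm (b z))\<^sup>2) * (norm (?f z))\<^sup>2)
      + (\<Sum>j. ennreal ((norm (cnj (b z j) * ?f z))\<^sup>2))" if "z \<in> \<Omega>" for z
  proof -
    have sm: "summable (\<lambda>j. (norm (b z j))\<^sup>2)" using b_mem[OF that] by (simp add: ell2_def)
    have "(\<Sum>j. ennreal ((norm (cnj (b z j) * ?f z))\<^sup>2)) = ennreal (\<Sum>j. (norm (b z j))\<^sup>2 * (norm (?f z))\<^sup>2)"
      unfolding norm_mult power_mult_distrib complex_mod_cnj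
      by (rule suminf_ennreal2) (auto intro: summable_mult2 sm)
    also have "(\<Sum>j. (norm (b z j))\<^sup>2 * (norm (?f z))\<^sup>2) = (ell2_norm (b z))\<^sup>2 * (norm (?f z))\<^sup>2"
      unfolding n2[OF that] by (rule suminf_mult2[OF sm, symmetric])
    moreover have "ennreal ((1 - (ell2_norm (b z))\<^sup>2) * (norm (?f z))\<^sup>2 + (ell2_norm (b z))\<^sup>2 * (norm (?f z))\<^sup>2)
        = ennreal ((1 - (ell2_norm (b z))\<^sup>2) * (norm (?f z))\<^sup>2) + ennreal ((ell2_norm (b z))\<^sup>2 * (norm (?f z))\<^sup>2)"
      using pos[OF that] by (intro ennreal_plus) auto
    ultimately show ?thesis by (simp add: left_diff_distrib)
  qed
  have "ennreal ?a = (\<integral>\<^sup>+z. ennreal ((norm (?f z))\<^sup>2) \<partial>\<mu>)"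
    by (rule nn_integral_L2_norm[symmetric]) (intro A_imp_L2 lincomb_K_mem c)
  also have "\<dots> = (\<integral>\<^sup>+z. ennreal ((1 - (ell2_norm (b z))\<^sup>2) * (norm (?f z))\<^sup>2)
      + (\<Sum>j. ennreal ((norm (cnj (b z j) * ?f z))\<^sup>2)) \<partial>\<mu>)"
    by (intro nn_integral_cong split) (simp add: space_\<mu>)
  also have "\<dots> = ?I + (\<Sum>j. \<integral>\<^sup>+z. ennreal ((norm (cnj (b z j) * ?f z))\<^sup>2) \<partial>\<mu>)"
    using measurable_cnj_b by (subst nn_integral_add) (auto simp: nn_integral_suminf)
  also have "(\<lambda>j. \<integral>\<^sup>+z. ennreal ((norm (cnj (b z j) * ?f z))\<^sup>2) \<partial>\<mu>) =
      (\<lambda>j. ennreal (s j) + (\<integral>\<^sup>+z. ennreal ((norm (Hank c j z))\<^sup>2) \<partial>\<mu>))"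
    by (rule ext) (simp add: nn_integral_L2_norm cnj_b_mult_mem lincomb_K_mem c Hank_mem norm_cnj_b_F s_def)
  also have "(\<Sum>j. ennreal (s j) + (\<integral>\<^sup>+z. ennreal ((norm (Hank c j z))\<^sup>2) \<partial>\<mu>)) = (\<Sum>j. ennreal (s j)) + ?H"
    by (rule suminf_add[symmetric]) auto
  also have "(\<Sum>j. ennreal (s j)) = ennreal (?a - ?q)"
    unfolding suminf_ennreal2[OF s_nonneg sums_summable[OF s]] sums_unique[OF s, symmetric] ..
  finally have 1: "ennreal ?a = ennreal (?a - ?q) + (?I + ?H)" by (simp add: add_ac)
  have "0 \<le> ?a - ?q" by (rule sums_le[OF s_nonneg sums_zero s])
  then have 2: "ennreal ?a = ennreal (?a - ?q) + ennreal ?q"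
    by (simp add: ennreal_plus[symmetric] del: ennreal_plus)
  \<comment> \<open>The common summand \<open>?a - ?q\<close>, the square of the norm of
    \<open>T\<^sup>* f\<close>, is finite and may be cancelled.\<close>
  from trans[OF 2[symmetric] 1] show ?thesis
    unfolding ennreal_add_left_cancel by simp
qed

end

lemma L2I:
  assumes "f \<in> borel_measurable M" "(\<integral>\<^sup>+x. ennreal ((norm (f x))\<^sup>2) \<partial>M) < \<infinity>"
  shows "f \<in> L2 M"
  using assms unfolding L2_def by (auto intro!: integrableI_nonneg)

section \<open>Local bounds by the norm of H(b)\<close>

context bergman_row_contraction
begin

text \<open>\<open>Q c\<close> is the quadratic form of \<open>1 - TT\<^sup>*\<close> at
  \<open>lincomb c K\<close>, and \<open>I\<close> its part weighted by
  \<open>1 - \<parallel>b\<parallel>\<^sup>2\<close>.\<close>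

abbreviation "Q c \<equiv> (ip_norm ipb (lincomb c KB))\<^sup>2"
abbreviation "I c \<equiv> \<integral>\<^sup>+z. ennreal ((1 - (ell2_norm (b z))\<^sup>2) * (norm (lincomb c K z))\<^sup>2) \<partial>\<mu>"

lemma one_minus_b_pos: "z \<in> \<Omega> \<Longrightarrow> 0 \<le> ell2_norm (b z)" "z \<in> \<Omega> \<Longrightarrow> 0 \<le> 1 - (ell2_norm (b z))\<^sup>2"
proof -
  assume z: "z \<in> \<Omega>"
  show "0 \<le> ell2_norm (b z)" using b_mem[OF z] by (simp add: ell2_norm_def ell2_def suminf_nonneg)
  then show "0 \<le> 1 - (ell2_norm (b z))\<^sup>2" using b_less_1[OF z] by (simp add: power_le_one)
qed

text \<open>The series is truncated because Fatou's lemma will be applied to finitely many Hankel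
  parts at a time.\<close>

lemma I_plus_Hank_le_Q:
  assumes "c \<in> fcoeffs"
  shows "I c + (\<Sum>j<J. \<integral>\<^sup>+z. ennreal ((norm (Hank c j z))\<^sup>2) \<partial>\<mu>) \<le> ennreal (Q c)"
  unfolding norm_lincomb_KB_eq[OF assms] by (intro add_left_mono sum_le_suminf) auto

lemma I_le_Q: "c \<in> fcoeffs \<Longrightarrow> I c \<le> ennreal (Q c)"
  using I_plus_Hank_le_Q[of c 0] by simp

lemma Hank_le_Q:
  assumes "c \<in> fcoeffs"
  shows "(\<integral>\<^sup>+z. ennreal ((norm (Hank c j z))\<^sup>2) \<partial>\<mu>) \<le> ennreal (Q c)"
proof -
  have "(\<integral>\<^sup>+z. ennreal ((norm (Hank c j z))\<^sup>2) \<partial>\<mu>) \<le> (\<Sum>j<Suc j. \<integral>\<^sup>+z. ennreal ((norm (Hank c j z))\<^sup>2) \<partial>\<mu>)"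
    by simp
  also have "\<dots> \<le> I c + (\<Sum>j<Suc j. \<integral>\<^sup>+z. ennreal ((norm (Hank c j z))\<^sup>2) \<partial>\<mu>)"
    by (rule add_increasing) auto
  also have "\<dots> \<le> ennreal (Q c)" by (rule I_plus_Hank_le_Q[OF assms])
  finally show ?thesis .
qed

text \<open>Elements of \<open>A\<close> vanish off the open set \<Omega>, so they are Borel on the
  whole space, where Lebesgue measure lives.\<close>

lemma A_borel_measurable: "f \<in> A \<Longrightarrow> f \<in> borel_measurable borel"
proof -
  assume f: "f \<in> A"
  then have "(\<lambda>x. indicator \<Omega> x *\<^sub>R f x) \<in> borel_measurable borel"
    by (intro borel_measurable_continuous_on_indicator analytic_function_on_imp_continuous_on A_imp_analytic)
      (use open_\<Omega> in auto)
  moreover have "(\<lambda>x. indicator \<Omega> x *\<^sub>R f x) = f"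
    using A_imp_functions_on[OF f] by (auto simp: functions_on_def indicator_def)
  ultimately show ?thesis by simp
qed

lemma measurable_norm_b: "(\<lambda>z. ell2_norm (b z)) \<in> borel_measurable \<mu>"
  by (intro borel_measurable_\<mu> continuous_on_ell2_norm analytic_b open_\<Omega>)

text \<open>Combines the ball mean inequality with the domination of Lebesgue measure on
  \<open>cball z R\<close>: balls of radius \<open>R / 2\<close> about points of
  \<open>ball z (R/2)\<close> stay inside, so one constant serves all of them. The bound
  \<open>q\<close> is a variable because different estimates will be inserted.\<close>

lemma A_local_bound:
  assumes R: "cball z R \<subseteq> \<Omega>" "R > 0"
  obtains C where "C > 0" "\<And>f q w. f \<in> A \<Longrightarrow> 0 \<le> q \<Longrightarrow>
    (\<integral>\<^sup>+x. ennreal ((norm (f x))\<^sup>2) * indicator (cball z R) x \<partial>\<mu>) \<le> ennreal q \<Longrightarrow>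
    w \<in> ball z (R/2) \<Longrightarrow> (norm (f w))\<^sup>2 \<le> C * q"
proof -
  have \<Omega>b: "\<Omega> \<in> sets borel" using open_\<Omega> by simp
  obtain c :: real where c: "c > 0" and dom: "\<And>u. u \<in> borel_measurable borel \<Longrightarrow>
    ennreal c * (\<integral>\<^sup>+x. u x * indicator (cball z R) x \<partial>lborel) \<le> (\<integral>\<^sup>+x. u x * indicator (cball z R) x \<partial>\<mu>)"
    by (rule nn_integral_dominates_lebesgue[OF sets_\<mu> \<Omega>b dominates compact_cball R(1)]) (rule that, assumption+)
  define V where "V = unit_ball_vol (real DIM(complex ^ 'd)) * (R/2) ^ DIM(complex ^ 'd)"
  have V: "V > 0" using R by (simp add: V_def)
  show thesis
  proof (rule that[of "1 / (c * V)"])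
    show "1 / (c * V) > 0" using c V by simp
    fix f q w assume f: "f \<in> A" and q: "0 \<le> q"
      and le: "(\<integral>\<^sup>+x. ennreal ((norm (f x))\<^sup>2) * indicator (cball z R) x \<partial>\<mu>) \<le> ennreal q"
      and w: "w \<in> ball z (R/2)"
    have [measurable]: "f \<in> borel_measurable borel" by (rule A_borel_measurable[OF f])
    have sub: "ball w (R/2) \<subseteq> cball z R"
    proof
      fix x assume "x \<in> ball w (R/2)"
      then show "x \<in> cball z R" using w dist_triangle[of z x w] by simp
    qed
    have "ennreal (c * ((norm (f w))\<^sup>2 * V)) = ennreal c * (ennreal ((norm (f w))\<^sup>2) * ennreal V)"
      using c V by (simp add: ennreal_mult)
    also have "ennreal V = emeasure lborel (ball w (R/2))"
      using R by (simp add: emeasure_ball V_def)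
    also have "ennreal ((norm (f w))\<^sup>2) * \<dots> \<le> (\<integral>\<^sup>+x. ennreal ((norm (f x))\<^sup>2) * indicator (ball w (R/2)) x \<partial>lborel)"
      by (rule norm_square_le_ball_mean[OF A_imp_analytic[OF f]]) (use sub R in blast)
    also have "\<dots> \<le> (\<integral>\<^sup>+x. ennreal ((norm (f x))\<^sup>2) * indicator (cball z R) x \<partial>lborel)"
    proof (rule nn_integral_mono)
      fix x
      show "ennreal ((norm (f x))\<^sup>2) * indicator (ball w (R/2)) x \<le> ennreal ((norm (f x))\<^sup>2) * indicator (cball z R) x"
        by (cases "x \<in> ball w (R/2)") (use subsetD[OF sub, of x] in \<open>simp_all del: mem_ball mem_cball\<close>)
    qed
    also have "ennreal c * \<dots> \<le> (\<integral>\<^sup>+x. ennreal ((norm (f x))\<^sup>2) * indicator (cball z R) x \<partial>\<mu>)"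
      by (rule dom) measurable
    also have "\<dots> \<le> ennreal q" by (rule le)
    finally have "c * ((norm (f w))\<^sup>2 * V) \<le> q" using q by (simp add: mult_left_mono)
    then show "(norm (f w))\<^sup>2 \<le> 1 / (c * V) * q" using c V by (simp add: field_simps)
  qed
qed

text \<open>On a compact ball \<open>\<parallel>b\<parallel>\<close> attains a maximum below 1, so
  \<open>Q\<close> controls the integral of \<open>|f|\<^sup>2\<close> there with factor
  \<open>1 / \<delta>\<close>. Since \<open>Toep\<close> is \<open>cnj b\<^sub>j f\<close> minus
  \<open>Hank\<close> and \<open>Q\<close> controls both, \<open>Toep\<close> is bounded too,
  uniformly in \<open>j\<close>.\<close>

lemma local_bound:
  assumes z: "z \<in> \<Omega>"
  obtains r C where "r > 0" "ball z r \<subseteq> \<Omega>" "C > 0"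
    "\<And>c w. c \<in> fcoeffs \<Longrightarrow> w \<in> ball z r \<Longrightarrow> (norm (lincomb c K w))\<^sup>2 \<le> C * Q c"
    "\<And>c w j. c \<in> fcoeffs \<Longrightarrow> w \<in> ball z r \<Longrightarrow> (norm (Toep c j w))\<^sup>2 \<le> C * Q c"
proof -
  obtain R where R: "R > 0" "cball z R \<subseteq> \<Omega>" using open_\<Omega> z open_contains_cball by blast
  let ?B = "cball z R"
  have "\<exists>x\<in>?B. \<forall>y\<in>?B. ell2_norm (b y) \<le> ell2_norm (b x)"
    by (rule continuous_attains_sup)
      (use R in \<open>auto intro: continuous_on_subset[OF continuous_on_ell2_norm[OF analytic_b open_\<Omega>]]\<close>)
  then obtain x where x: "x \<in> ?B" "\<And>y. y \<in> ?B \<Longrightarrow> ell2_norm (b y) \<le> ell2_norm (b x)" by blast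
  define \<delta> where "\<delta> = 1 - (ell2_norm (b x))\<^sup>2"
  have x\<Omega>: "x \<in> \<Omega>" using x R by blast
  have "(ell2_norm (b x))\<^sup>2 < 1"
    using b_less_1[OF x\<Omega>] one_minus_b_pos(1)[OF x\<Omega>] by (simp add: power_less_one_iff abs_square_less_1)
  then have \<delta>: "\<delta> > 0" by (simp add: \<delta>_def)
  have \<delta>_le: "\<delta> \<le> 1 - (ell2_norm (b y))\<^sup>2" if "y \<in> ?B" for y
    unfolding \<delta>_def using x(2)[OF that] one_minus_b_pos(1)[of y] that R by (auto intro!: power_mono)
  obtain C where C: "C > 0" and bound: "\<And>f q w. f \<in> A \<Longrightarrow> 0 \<le> q \<Longrightarrow>
    (\<integral>\<^sup>+x. ennreal ((norm (f x))\<^sup>2) * indicator ?B x \<partial>\<mu>) \<le> ennreal q \<Longrightarrow>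
    w \<in> ball z (R/2) \<Longrightarrow> (norm (f w))\<^sup>2 \<le> C * q"
    by (rule A_local_bound[OF R(2,1)]) (rule that, assumption+)
  have F_le: "(\<integral>\<^sup>+x. ennreal ((norm (lincomb c K x))\<^sup>2) * indicator ?B x \<partial>\<mu>) \<le> ennreal (1/\<delta> * Q c)"
    if c: "c \<in> fcoeffs" for c
  proof -
    have [measurable]: "lincomb c K \<in> borel_measurable \<mu>" using A_imp_L2[OF lincomb_K_mem[OF c]] by (simp add: L2_def)
    note [measurable] = measurable_norm_b
    have "(\<integral>\<^sup>+x. ennreal ((norm (lincomb c K x))\<^sup>2) * indicator ?B x \<partial>\<mu>)
        \<le> (\<integral>\<^sup>+y. ennreal (1/\<delta>) * ennreal ((1 - (ell2_norm (b y))\<^sup>2) * (norm (lincomb c K y))\<^sup>2) \<partial>\<mu>)"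
    proof (rule nn_integral_mono)
      fix y assume "y \<in> space \<mu>"
      show "ennreal ((norm (lincomb c K y))\<^sup>2) * indicator ?B y
          \<le> ennreal (1/\<delta>) * ennreal ((1 - (ell2_norm (b y))\<^sup>2) * (norm (lincomb c K y))\<^sup>2)"
      proof (cases "y \<in> ?B")
        case True
        have "(norm (lincomb c K y))\<^sup>2 * \<delta> \<le> (1 - (ell2_norm (b y))\<^sup>2) * (norm (lincomb c K y))\<^sup>2"
          using mult_right_mono[OF \<delta>_le[OF True], of "(norm (lincomb c K y))\<^sup>2"] by (simp add: mult.commute)
        then have "(norm (lincomb c K y))\<^sup>2 \<le> 1/\<delta> * ((1 - (ell2_norm (b y))\<^sup>2) * (norm (lincomb c K y))\<^sup>2)"
          using \<delta> by (simp add: pos_le_divide_eq)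
        then show ?thesis using \<delta> True by (simp add: ennreal_mult'[symmetric] ennreal_leI)
      qed simp
    qed
    also have "\<dots> = ennreal (1/\<delta>) * I c" by (rule nn_integral_cmult) measurable
    also have "\<dots> \<le> ennreal (1/\<delta>) * ennreal (Q c)" by (intro mult_left_mono I_le_Q c) simp
    also have "\<dots> = ennreal (1/\<delta> * Q c)" by (rule ennreal_mult[symmetric]) (use \<delta> in simp_all)
    finally show ?thesis .
  qed
  \<comment> \<open>The square of a difference costs a factor 2 on each part:
    \<open>2 / \<delta>\<close> comes from \<open>F_le\<close> and 2 from
    \<open>Hank_le_Q\<close>.\<close>
  have T_le: "(\<integral>\<^sup>+x. ennreal ((norm (Toep c j x))\<^sup>2) * indicator ?B x \<partial>\<mu>) \<le> ennreal ((2/\<delta> + 2) * Q c)"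
    if c: "c \<in> fcoeffs" for c j
  proof -
    have [measurable]: "lincomb c K \<in> borel_measurable \<mu>" "Hank c j \<in> borel_measurable \<mu>"
      using A_imp_L2[OF lincomb_K_mem[OF c]] Hank_mem[OF c] by (simp_all add: L2_def)
    have two: "2 * ennreal p + 2 * ennreal q = ennreal (2 * p + 2 * q)" if "0 \<le> p" "0 \<le> q" for p q :: real
      using that by (simp add: ennreal_mult)
    have [measurable]: "?B \<in> sets \<mu>"
      using R unfolding sets_\<mu> by (auto simp: sets_restrict_space_iff open_\<Omega>)
    have "(\<integral>\<^sup>+x. ennreal ((norm (Toep c j x))\<^sup>2) * indicator ?B x \<partial>\<mu>)
        \<le> (\<integral>\<^sup>+x. 2 * (ennreal ((norm (lincomb c K x))\<^sup>2) * indicator ?B x) + 2 * ennreal ((norm (Hank c j x))\<^sup>2) \<partial>\<mu>)"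
    proof (rule nn_integral_mono)
      fix y assume y: "y \<in> space \<mu>"
      have "Toep c j y = cnj (b y j) * lincomb c K y + (- Hank c j y)" by (simp add: Hank_def)
      then have "(norm (Toep c j y))\<^sup>2 \<le> 2 * (norm (cnj (b y j) * lincomb c K y))\<^sup>2 + 2 * (norm (Hank c j y))\<^sup>2"
        using norm_add_square_le[of "cnj (b y j) * lincomb c K y" "- Hank c j y"] by simp
      moreover have "(norm (cnj (b y j) * lincomb c K y))\<^sup>2 \<le> (norm (lincomb c K y))\<^sup>2"
        using norm_b_le_1[of y j] y by (intro power_mono) (auto simp: norm_mult space_\<mu> mult_left_le_one_le)
      ultimately have "(norm (Toep c j y))\<^sup>2 \<le> 2 * (norm (lincomb c K y))\<^sup>2 + 2 * (norm (Hank c j y))\<^sup>2"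
        by linarith
      then have "ennreal ((norm (Toep c j y))\<^sup>2) \<le> ennreal (2 * (norm (lincomb c K y))\<^sup>2 + 2 * (norm (Hank c j y))\<^sup>2)"
        by (rule ennreal_leI)
      also have "\<dots> = 2 * ennreal ((norm (lincomb c K y))\<^sup>2) + 2 * ennreal ((norm (Hank c j y))\<^sup>2)"
        by (rule two[symmetric]) simp_all
      finally show "ennreal ((norm (Toep c j y))\<^sup>2) * indicator ?B y
        \<le> 2 * (ennreal ((norm (lincomb c K y))\<^sup>2) * indicator ?B y) + 2 * ennreal ((norm (Hank c j y))\<^sup>2)"
        by (auto simp: indicator_def)
    qed
    also have "\<dots> = 2 * (\<integral>\<^sup>+x. ennreal ((norm (lincomb c K x))\<^sup>2) * indicator ?B x \<partial>\<mu>)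
        + 2 * (\<integral>\<^sup>+x. ennreal ((norm (Hank c j x))\<^sup>2) \<partial>\<mu>)"
      by (subst nn_integral_add) (auto simp: nn_integral_cmult)
    also have "\<dots> \<le> 2 * ennreal (1/\<delta> * Q c) + 2 * ennreal (Q c)"
      by (intro add_mono mult_left_mono F_le Hank_le_Q c) auto
    also have "\<dots> = ennreal (2 * (1/\<delta> * Q c) + 2 * Q c)"
      by (rule two) (use \<delta> in simp_all)
    also have "2 * (1/\<delta> * Q c) + 2 * Q c = (2/\<delta> + 2) * Q c" by (simp add: distrib_right)
    finally show ?thesis .
  qed
  let ?C = "C * (2/\<delta> + 2)"
  show thesis
  proof (rule that[of "R/2" ?C])
    show "R/2 > 0" "?C > 0" using R \<delta> C by (simp_all add: add_pos_pos)
    show "ball z (R/2) \<subseteq> \<Omega>" using R by force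
    fix c w assume c: "c \<in> fcoeffs" and w: "w \<in> ball z (R/2)"
    show "(norm (Toep c j w))\<^sup>2 \<le> ?C * Q c" for j
      using bound[OF Toep_mem[OF c] _ T_le[OF c] w] \<delta> by (simp add: mult.assoc)
    have "(norm (lincomb c K w))\<^sup>2 \<le> C * (1/\<delta> * Q c)"
      by (rule bound[OF lincomb_K_mem[OF c] _ F_le[OF c] w]) (use \<delta> in simp)
    also have "\<dots> \<le> C * ((2/\<delta> + 2) * Q c)"
      using C \<delta> by (intro mult_left_mono mult_right_mono) (auto simp: field_simps)
    finally show "(norm (lincomb c K w))\<^sup>2 \<le> ?C * Q c" by (simp add: mult.assoc)
  qed
qed

section \<open>The kernels \<open>k\<close> as elements of H(b)\<close>

lemma complete_Hb: "complete_inner_on Hb ipb"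
  using Hb unfolding hilbert_function_space_def by blast

lemma Hb_functions_on: "u \<in> Hb \<Longrightarrow> u \<in> functions_on \<Omega>"
  using Hb unfolding hilbert_function_space_def function_subspace_def by blast

text \<open>By \<open>local_bound\<close> the functional sending \<open>lincomb c KB\<close> to
  \<open>lincomb c K z\<close> is bounded, so the Riesz theorem represents it by some
  \<open>h\<close>. Testing on a single \<open>KB x\<close> shows that
  \<open>h x = cnj (k z x) = k x z\<close>.\<close>

lemma kernel_mem_Hb:
  assumes z: "z \<in> \<Omega>"
  shows "K z \<in> Hb" "\<And>c. c \<in> fcoeffs \<Longrightarrow> ipb (lincomb c KB) (K z) = lincomb c K z"
proof -
  obtain r C where r: "r > 0" and C: "C > 0"
    and le: "\<And>c w. c \<in> fcoeffs \<Longrightarrow> w \<in> ball z r \<Longrightarrow> (norm (lincomb c K w))\<^sup>2 \<le> C * Q c"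
    using local_bound[OF z] by metis
  let ?G = "{(lincomb c KB, lincomb c K z) | c. c \<in> fcoeffs}"
  obtain h where h: "h \<in> Hb" "\<And>u l. (u, l) \<in> ?G \<Longrightarrow> ipb u h = l"
  proof (rule B.Riesz_graph[OF complete_Hb, of ?G "sqrt C"])
    show "((\<lambda>x. 0), 0) \<in> ?G"
      using coeffs_on_zero[of \<Omega>] lincomb_zero[of KB] lincomb_zero[of K] by (metis (mono_tags, lifting) mem_Collect_eq)
  next
    fix u l assume "(u, l) \<in> ?G"
    then obtain c where c: "c \<in> fcoeffs" "u = lincomb c KB" "l = lincomb c K z" by blast
    then show "u \<in> Hb" by (simp add: lincomb_KB_mem)
    have "(norm l)\<^sup>2 \<le> (sqrt C * ip_norm ipb u)\<^sup>2"
      using le[OF c(1), of z] r C c by (simp add: power_mult_distrib)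
    then show "norm l \<le> sqrt C * ip_norm ipb u"
      by (rule power2_le_imp_le) (use C c in \<open>simp add: B.ip_norm_nonneg lincomb_KB_mem\<close>)
    show "((\<lambda>x. a * u x), a * l) \<in> ?G" for a
      using coeffs_on_scale[OF c(1), of a] c(2,3)
      by (intro CollectI exI[of _ "\<lambda>x. a * c x"]) (simp add: fun_eq_iff lincomb_scale[OF c(1)])
    fix u' l' assume "(u', l') \<in> ?G"
    then obtain d where d: "d \<in> fcoeffs" "u' = lincomb d KB" "l' = lincomb d K z" by blast
    show "((\<lambda>x. u x + u' x), l + l') \<in> ?G"
      using coeffs_on_add[OF c(1) d(1)] c(2,3) d(2,3)
      by (intro CollectI exI[of _ "\<lambda>x. c x + d x"]) (simp add: fun_eq_iff lincomb_add[OF c(1) d(1)])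
  qed (rule that, assumption+)
  have h_eq: "ipb (lincomb c KB) h = lincomb c K z" if "c \<in> fcoeffs" for c
    by (rule h(2)) (use that in blast)
  have "h x = K z x" for x
  proof (cases "x \<in> \<Omega>")
    case True
    have "(\<lambda>y. if y = x then 1 else 0) \<in> fcoeffs" using True by (simp add: coeffs_on_def)
    from h_eq[OF this] have "ipb (KB x) h = K x z" by (simp add: lincomb_single)
    then have "h x = cnj (K x z)"
      using ip_KB[OF h(1) True] B.ip_cnj[OF KB_mem[OF True] h(1)] by simp
    then show ?thesis using True z k_cnj[OF True z] by (simp add: kernel_at_def)
  next
    case False
    then show ?thesis using Hb_functions_on[OF h(1)] by (simp add: functions_on_def kernel_at_def)
  qed
  then have "K z = h" by auto
  with h(1) h_eq show "K z \<in> Hb" "\<And>c. c \<in> fcoeffs \<Longrightarrow> ipb (lincomb c KB) (K z) = lincomb c K z"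
    by simp_all
qed

text \<open>A vector orthogonal to every \<open>KB x\<close> vanishes on \<Omega> by the reproducing
  property, so combinations of these kernels are dense.\<close>

lemma approx_by_KB:
  assumes "u \<in> Hb" "e > 0"
  obtains c where "c \<in> fcoeffs" "ip_norm ipb (\<lambda>x. lincomb c KB x - u x) < e"
proof -
  let ?S = "{lincomb c KB | c. c \<in> fcoeffs}"
  have "dense_in_space ?S Hb ipb"
  proof (rule B.dense_if_orthogonal_trivial[OF complete_Hb])
    show "?S \<subseteq> Hb" by (auto intro: lincomb_KB_mem)
    show "(\<lambda>x. 0) \<in> ?S"
      using coeffs_on_zero[of \<Omega>] lincomb_zero[of KB] by (metis (mono_tags, lifting) mem_Collect_eq)
    fix f g assume "f \<in> ?S" "g \<in> ?S"
    then obtain c d where c: "c \<in> fcoeffs" "f = lincomb c KB" and d: "d \<in> fcoeffs" "g = lincomb d KB" by blast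
    show "(\<lambda>x. f x + g x) \<in> ?S"
      using coeffs_on_add[OF c(1) d(1)] c(2) d(2)
      by (intro CollectI exI[of _ "\<lambda>x. c x + d x"]) (simp add: fun_eq_iff lincomb_add[OF c(1) d(1)])
    show "(\<lambda>x. a * f x) \<in> ?S" for a
      using coeffs_on_scale[OF c(1), of a] c(2)
      by (intro CollectI exI[of _ "\<lambda>x. a * c x"]) (simp add: fun_eq_iff lincomb_scale[OF c(1)])
  next
    fix v assume v: "v \<in> Hb" and orth: "\<And>w. w \<in> ?S \<Longrightarrow> ipb w v = 0"
    have "v x = 0" for x
    proof (cases "x \<in> \<Omega>")
      case True
      have "KB x = lincomb (\<lambda>y. if y = x then 1 else 0) KB" by (simp add: lincomb_single)
      moreover have "(\<lambda>y. if y = x then 1 else 0) \<in> fcoeffs" using True by (simp add: coeffs_on_def)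
      ultimately have "ipb (KB x) v = 0" by (intro orth) blast
      then show ?thesis using ip_KB[OF v True] B.ip_cnj[OF KB_mem[OF True] v] by simp
    next
      case False
      then show ?thesis using Hb_functions_on[OF v] by (simp add: functions_on_def)
    qed
    then show "v = (\<lambda>x. 0)" by auto
  qed
  then obtain g where "g \<in> ?S" "ip_norm ipb (\<lambda>x. u x - g x) < e"
    using assms unfolding dense_in_space_def by blast
  then show thesis using that B.ip_norm_diff_commute[OF assms(1)] lincomb_KB_mem by auto
qed

text \<open>The Fatou step: the limit of the Toeplitz parts is an analytic function \<open>g j\<close>, and the
  Hankel parts are orthogonal to it, so that adding \<open>g j\<close> can only increase their norm.\<close>
lemma Q_le_of_Cauchy:
  assumes c: "c \<in> fcoeffs" and d: "\<And>m. d m \<in> fcoeffs"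
    and F: "\<And>z. z \<in> \<Omega> \<Longrightarrow> (\<lambda>m. lincomb (d m) K z) \<longlonglongrightarrow> 0"
    and g: "\<And>j. analytic_function_on \<Omega> (g j)" and g_lim: "\<And>j z. z \<in> \<Omega> \<Longrightarrow> (\<lambda>m. Toep (d m) j z) \<longlonglongrightarrow> g j z"
    and Q: "\<And>m. m \<ge> N \<Longrightarrow> Q (\<lambda>x. c x - d m x) \<le> e" and e: "e \<ge> 0"
  shows "Q c \<le> e"
proof -
  \<comment> \<open>Members of \<open>A\<close> vanish off \<Omega>, while the limits are prescribed
    only on \<Omega>.\<close>
  define g0 where "g0 = (\<lambda>j z. if z \<in> \<Omega> then g j z else 0)"
  have g0: "analytic_function_on \<Omega> (g0 j)" for j
    by (rule analytic_function_on_cong[OF open_\<Omega> _ g[of j]]) (simp add: g0_def)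
  have g0_meas [measurable]: "g0 j \<in> borel_measurable \<mu>" for j
    by (intro borel_measurable_\<mu> analytic_function_on_imp_continuous_on g0)
  have FH_meas [measurable]: "lincomb c' K \<in> borel_measurable \<mu>" "Hank c' j \<in> borel_measurable \<mu>" if "c' \<in> fcoeffs" for c' j
    using A_imp_L2[OF lincomb_K_mem[OF that]] Hank_mem[OF that] by (simp_all add: L2_def)
  note [measurable] = measurable_norm_b
  let ?\<beta> = "\<lambda>z. 1 - (ell2_norm (b z))\<^sup>2"
  let ?d = "\<lambda>m x. c x - d m x"
  have dm: "?d m \<in> fcoeffs" for m by (intro coeffs_on_diff c d)
  \<comment> \<open>For the coefficients \<open>c - d m\<close> the kernel combinations tend to
    \<open>lincomb c K\<close>, and the Hankel parts tend to \<open>Hank c j + g0 j\<close> because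
    \<open>Hank (d m) j\<close> tends to \<open>- g j\<close>. Fatou's lemma keeps the bound
    \<open>e\<close>.\<close>
  have main: "I c + (\<Sum>j<J. \<integral>\<^sup>+z. ennreal ((norm (Hank c j z + g0 j z))\<^sup>2) \<partial>\<mu>) \<le> ennreal e" for J
  proof -
    have split: "(\<integral>\<^sup>+z. ennreal (?\<beta> z * (norm (f z))\<^sup>2 + (\<Sum>j<J. (norm (h j z))\<^sup>2)) \<partial>\<mu>) =
      (\<integral>\<^sup>+z. ennreal (?\<beta> z * (norm (f z))\<^sup>2) \<partial>\<mu>) + (\<Sum>j<J. \<integral>\<^sup>+z. ennreal ((norm (h j z))\<^sup>2) \<partial>\<mu>)"
      if [measurable]: "f \<in> borel_measurable \<mu>" "\<And>j. h j \<in> borel_measurable \<mu>"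
      for f :: "complex ^ 'd \<Rightarrow> complex" and h :: "nat \<Rightarrow> complex ^ 'd \<Rightarrow> complex"
    proof -
      have "(\<integral>\<^sup>+z. ennreal (?\<beta> z * (norm (f z))\<^sup>2 + (\<Sum>j<J. (norm (h j z))\<^sup>2)) \<partial>\<mu>) =
        (\<integral>\<^sup>+z. ennreal (?\<beta> z * (norm (f z))\<^sup>2) + (\<Sum>j<J. ennreal ((norm (h j z))\<^sup>2)) \<partial>\<mu>)"
        using one_minus_b_pos(2) by (intro nn_integral_cong) (auto simp: space_\<mu> ennreal_plus sum_nonneg sum_ennreal)
      then show ?thesis by (simp add: nn_integral_add nn_integral_sum del: sum_ennreal)
    qed
    define v where "v = (\<lambda>m z. ?\<beta> z * (norm (lincomb (?d m) K z))\<^sup>2 + (\<Sum>j<J. (norm (Hank (?d m) j z))\<^sup>2))"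
    define v' where "v' = (\<lambda>z. ?\<beta> z * (norm (lincomb c K z))\<^sup>2 + (\<Sum>j<J. (norm (Hank c j z + g0 j z))\<^sup>2))"
    have [measurable]: "v m \<in> borel_measurable \<mu>" for m
      unfolding v_def using FH_meas[OF dm] by measurable
    have lim: "(\<lambda>m. v m z) \<longlonglongrightarrow> v' z" if z: "z \<in> \<Omega>" for z
    proof -
      have A: "(\<lambda>m. lincomb (?d m) K z) \<longlonglongrightarrow> lincomb c K z - 0"
        unfolding lincomb_diff[OF c d] by (intro tendsto_diff tendsto_const F z)
      have B: "(\<lambda>m. Hank (?d m) j z) \<longlonglongrightarrow> Hank c j z - (cnj (b z j) * 0 - g j z)" for j
        unfolding Hank_diff[OF c d] Hank_def[of "d _"]
        by (intro tendsto_diff tendsto_mult tendsto_const F g_lim z)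
      have "(\<lambda>m. v m z) \<longlonglongrightarrow> ?\<beta> z * (norm (lincomb c K z - 0))\<^sup>2 + (\<Sum>j<J. (norm (Hank c j z - (cnj (b z j) * 0 - g j z)))\<^sup>2)"
        unfolding v_def
        by (intro tendsto_add tendsto_mult tendsto_const tendsto_power tendsto_norm tendsto_sum A B)
      then show ?thesis using z by (simp add: v'_def g0_def)
    qed
    have "I c + (\<Sum>j<J. \<integral>\<^sup>+z. ennreal ((norm (Hank c j z + g0 j z))\<^sup>2) \<partial>\<mu>) = (\<integral>\<^sup>+z. ennreal (v' z) \<partial>\<mu>)"
      unfolding v'_def by (rule split[symmetric]) (intro borel_measurable_add FH_meas[OF c] g0_meas)+
    also have "\<dots> = (\<integral>\<^sup>+z. liminf (\<lambda>m. ennreal (v m z)) \<partial>\<mu>)"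
      by (intro nn_integral_cong lim_imp_Liminf[symmetric] tendsto_ennrealI lim) (auto simp: space_\<mu>)
    also have "\<dots> \<le> liminf (\<lambda>m. \<integral>\<^sup>+z. ennreal (v m z) \<partial>\<mu>)"
      by (rule nn_integral_liminf) measurable
    also have "\<dots> \<le> ennreal e"
    proof (rule Liminf_le)
      have "(\<integral>\<^sup>+z. ennreal (v m z) \<partial>\<mu>) \<le> ennreal e" if "m \<ge> N" for m
      proof -
        have "(\<integral>\<^sup>+z. ennreal (v m z) \<partial>\<mu>) = I (?d m) + (\<Sum>j<J. \<integral>\<^sup>+z. ennreal ((norm (Hank (?d m) j z))\<^sup>2) \<partial>\<mu>)"
          unfolding v_def by (rule split) (rule FH_meas[OF dm])+
        also have "\<dots> \<le> ennreal (Q (?d m))" by (rule I_plus_Hank_le_Q[OF dm])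
        also have "\<dots> \<le> ennreal e" by (rule ennreal_leI[OF Q[OF that]])
        finally show ?thesis .
      qed
      then show "\<forall>\<^sub>F m in sequentially. (\<integral>\<^sup>+z. ennreal (v m z) \<partial>\<mu>) \<le> ennreal e"
        unfolding eventually_sequentially by blast
    qed simp
    finally show ?thesis .
  qed
  \<comment> \<open>\<open>main\<close> makes \<open>Hank c j + g0 j\<close> square-integrable,
    which puts \<open>g0 j\<close> in \<open>A\<close>; Pythagoras then allows \<open>g0 j\<close>
    to be dropped.\<close>
  have Hank_le: "(\<integral>\<^sup>+z. ennreal ((norm (Hank c j z))\<^sup>2) \<partial>\<mu>) \<le> (\<integral>\<^sup>+z. ennreal ((norm (Hank c j z + g0 j z))\<^sup>2) \<partial>\<mu>)" for j
  proof -
    have "(\<integral>\<^sup>+z. ennreal ((norm (Hank c j z + g0 j z))\<^sup>2) \<partial>\<mu>)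
        \<le> (\<Sum>j<Suc j. \<integral>\<^sup>+z. ennreal ((norm (Hank c j z + g0 j z))\<^sup>2) \<partial>\<mu>)"
      by simp
    also have "\<dots> \<le> I c + (\<Sum>j<Suc j. \<integral>\<^sup>+z. ennreal ((norm (Hank c j z + g0 j z))\<^sup>2) \<partial>\<mu>)"
      by (rule add_increasing) auto
    also have "\<dots> \<le> ennreal e" by (rule main)
    also have "\<dots> < \<infinity>" by simp
    finally have HgL2: "(\<lambda>z. Hank c j z + g0 j z) \<in> L2 \<mu>"
      using FH_meas[OF c] by (intro L2I) auto
    have "g0 j = (\<lambda>z. (Hank c j z + g0 j z) - Hank c j z)" by simp
    then have "g0 j \<in> L2 \<mu>" using L.diff_mem[OF HgL2 Hank_mem[OF c, of j]] by simp
    then have g0A: "g0 j \<in> A" using g0 by (simp add: L2a_def functions_on_def g0_def)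
    have "(ip_norm ipm (\<lambda>z. g0 j z + Hank c j z))\<^sup>2 = (ip_norm ipm (g0 j))\<^sup>2 + (ip_norm ipm (Hank c j))\<^sup>2"
      using L.ip_norm_add_square[OF A_imp_L2[OF g0A] Hank_mem[OF c, of j]] Hank_orthogonal[OF c g0A, of j] by simp
    then have "(ip_norm ipm (Hank c j))\<^sup>2 \<le> (ip_norm ipm (\<lambda>z. Hank c j z + g0 j z))\<^sup>2"
      by (simp add: add.commute)
    then show ?thesis
      using nn_integral_L2_norm[OF Hank_mem[OF c, of j]] nn_integral_L2_norm[OF HgL2] by (simp add: ennreal_leI)
  qed
  \<comment> \<open>The full series is the supremum of its partial sums, and each of these is
    bounded through \<open>main\<close>.\<close>
  have "ennreal (Q c) = I c + (SUP J. \<Sum>j<J. \<integral>\<^sup>+z. ennreal ((norm (Hank c j z))\<^sup>2) \<partial>\<mu>)"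
    unfolding norm_lincomb_KB_eq[OF c] suminf_eq_SUP ..
  also have "\<dots> = (SUP J. I c + (\<Sum>j<J. \<integral>\<^sup>+z. ennreal ((norm (Hank c j z))\<^sup>2) \<partial>\<mu>))"
    by (rule ennreal_SUP_add_right) simp
  also have "\<dots> \<le> ennreal e"
  proof (rule SUP_least)
    fix J
    have "I c + (\<Sum>j<J. \<integral>\<^sup>+z. ennreal ((norm (Hank c j z))\<^sup>2) \<partial>\<mu>)
        \<le> I c + (\<Sum>j<J. \<integral>\<^sup>+z. ennreal ((norm (Hank c j z + g0 j z))\<^sup>2) \<partial>\<mu>)"
      by (intro add_left_mono sum_mono Hank_le)
    then show "I c + (\<Sum>j<J. \<integral>\<^sup>+z. ennreal ((norm (Hank c j z))\<^sup>2) \<partial>\<mu>) \<le> ennreal e"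
      using main[of J] by (rule order_trans)
  qed
  finally show ?thesis using e by simp
qed

section \<open>Vectors orthogonal to the kernels, and density\<close>

text \<open>Along approximants \<open>lincomb (c n) KB\<close> of \<open>u\<close>, orthogonality to
  \<open>K z\<close> means that \<open>lincomb (c n) K z\<close> tends to 0.
  \<open>Q_le_of_Cauchy\<close>, used with one late \<open>c n\<close> against the whole sequence,
  then shows that the approximants tend to 0 in H(b).\<close>

lemma orthogonal_to_kernels_imp_zero:
  assumes u: "u \<in> Hb" and orth: "\<And>z. z \<in> \<Omega> \<Longrightarrow> ipb (K z) u = 0"
  shows "u = (\<lambda>x. 0)"
proof -
  have "\<exists>c. c \<in> fcoeffs \<and> ip_norm ipb (\<lambda>x. lincomb c KB x - u x) < inverse (real (Suc n))" for n
    by (rule approx_by_KB[OF u, of "inverse (real (Suc n))"]) auto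
  then obtain c where c: "\<And>n. c n \<in> fcoeffs"
    and cu: "\<And>n. ip_norm ipb (\<lambda>x. lincomb (c n) KB x - u x) < inverse (real (Suc n))"
    by metis
  have cu_lim: "(\<lambda>n. ip_norm ipb (\<lambda>x. lincomb (c n) KB x - u x)) \<longlonglongrightarrow> 0"
  proof (rule tendsto_sandwich[OF _ _ tendsto_const LIMSEQ_inverse_real_of_nat])
    show "\<forall>\<^sub>F n in sequentially. 0 \<le> ip_norm ipb (\<lambda>x. lincomb (c n) KB x - u x)"
      by (intro always_eventually allI B.ip_norm_nonneg B.diff_mem lincomb_KB_mem c u)
    show "\<forall>\<^sub>F n in sequentially. ip_norm ipb (\<lambda>x. lincomb (c n) KB x - u x) \<le> inverse (real (Suc n))"
      by (intro always_eventually allI less_imp_le cu)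
  qed
  have small: "\<exists>N. \<forall>m\<ge>N. \<forall>n\<ge>N. Q (\<lambda>x. c m x - c n x) \<le> e" if e: "e > 0" for e
  proof -
    have "\<forall>\<^sub>F n in sequentially. ip_norm ipb (\<lambda>x. lincomb (c n) KB x - u x) < sqrt e / 2"
      using e by (intro order_tendstoD(2)[OF cu_lim]) simp
    then obtain N where N: "\<And>n. n \<ge> N \<Longrightarrow> ip_norm ipb (\<lambda>x. lincomb (c n) KB x - u x) < sqrt e / 2"
      unfolding eventually_sequentially by blast
    have "Q (\<lambda>x. c m x - c n x) \<le> e" if "m \<ge> N" "n \<ge> N" for m n
    proof -
      have "lincomb (\<lambda>x. c m x - c n x) KB = (\<lambda>z. lincomb (c m) KB z - lincomb (c n) KB z)"
        by (rule ext) (rule lincomb_diff[OF c c])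
      then have "ip_norm ipb (lincomb (\<lambda>x. c m x - c n x) KB) \<le> sqrt e"
        using B.ip_norm_triangle_diff[OF lincomb_KB_mem[OF c] lincomb_KB_mem[OF c] u, of m n] N[OF that(1)] N[OF that(2)] by simp
      then have "Q (\<lambda>x. c m x - c n x) \<le> (sqrt e)\<^sup>2"
        by (intro power_mono B.ip_norm_nonneg lincomb_KB_mem coeffs_on_diff c)
      then show ?thesis using e by simp
    qed
    then show ?thesis by blast
  qed
  have F0: "(\<lambda>n. lincomb (c n) K z) \<longlonglongrightarrow> 0" if z: "z \<in> \<Omega>" for z
  proof -
    have "(\<lambda>n. ipb (lincomb (c n) KB) (K z)) \<longlonglongrightarrow> ipb u (K z)"
      by (rule B.tendsto_ip[OF lincomb_KB_mem[OF c] u kernel_mem_Hb(1)[OF z] cu_lim])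
    moreover have "ipb u (K z) = 0"
      using B.ip_cnj[OF kernel_mem_Hb(1)[OF z] u] orth[OF z] by simp
    ultimately show ?thesis by (simp add: kernel_mem_Hb(2)[OF z c])
  qed
  \<comment> \<open>The local bound for \<open>Toep\<close> turns the Cauchy property for
    \<open>Q\<close> into locally uniform convergence, so that the limit is analytic.\<close>
  have "\<exists>g. analytic_function_on \<Omega> g \<and> (\<forall>z\<in>\<Omega>. (\<lambda>n. Toep (c n) j z) \<longlonglongrightarrow> g z)" for j
  proof -
    obtain g where "analytic_function_on \<Omega> g" "\<And>z. z \<in> \<Omega> \<Longrightarrow> (\<lambda>n. Toep (c n) j z) \<longlonglongrightarrow> g z"
    proof (rule analytic_function_on_locally_uniform_limit[of \<Omega> "\<lambda>n. Toep (c n) j"])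
      show "analytic_function_on \<Omega> (Toep (c n) j)" for n
        by (intro A_imp_analytic Toep_mem c)
      fix z assume "z \<in> \<Omega>"
      then obtain r C where r: "r > 0" "ball z r \<subseteq> \<Omega>" and C: "C > 0"
        and le: "\<And>c w j. c \<in> fcoeffs \<Longrightarrow> w \<in> ball z r \<Longrightarrow> (norm (Toep c j w))\<^sup>2 \<le> C * Q c"
        using local_bound by metis
      have "\<exists>N. \<forall>m\<ge>N. \<forall>n\<ge>N. \<forall>w\<in>ball z r. norm (Toep (c m) j w - Toep (c n) j w) \<le> e" if e: "e > 0" for e
      proof -
        obtain N where N: "\<And>m n. m \<ge> N \<Longrightarrow> n \<ge> N \<Longrightarrow> Q (\<lambda>x. c m x - c n x) \<le> e\<^sup>2 / C"
          using small[of "e\<^sup>2 / C"] e C by auto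
        have "norm (Toep (c m) j w - Toep (c n) j w) \<le> e" if "m \<ge> N" "n \<ge> N" "w \<in> ball z r" for m n w
        proof (rule power2_le_imp_le)
          have "(norm (Toep (c m) j w - Toep (c n) j w))\<^sup>2 \<le> C * Q (\<lambda>x. c m x - c n x)"
            using le[OF coeffs_on_diff[OF c c] that(3), of m n j] by (simp add: Toep_diff[OF c c])
          also have "\<dots> \<le> C * (e\<^sup>2 / C)" using N[OF that(1,2)] C by (intro mult_left_mono) auto
          also have "\<dots> = e\<^sup>2" using C by simp
          finally show "(norm (Toep (c m) j w - Toep (c n) j w))\<^sup>2 \<le> e\<^sup>2" .
        qed (use e in simp)
        then show ?thesis by blast
      qed
      with r show "\<exists>r>0. ball z r \<subseteq> \<Omega> \<and> (\<forall>e>0. \<exists>N. \<forall>m\<ge>N. \<forall>n\<ge>N. \<forall>w\<in>ball z r. norm (Toep (c m) j w - Toep (c n) j w) \<le> e)"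
        by blast
    qed (rule that, assumption+)
    then show ?thesis by blast
  qed
  then obtain g where g: "\<And>j. analytic_function_on \<Omega> (g j)"
    "\<And>j z. z \<in> \<Omega> \<Longrightarrow> (\<lambda>n. Toep (c n) j z) \<longlonglongrightarrow> g j z" by metis
  have "ip_norm ipb u \<le> e" if e: "e > 0" for e
  proof -
    obtain N where N: "\<And>m n. m \<ge> N \<Longrightarrow> n \<ge> N \<Longrightarrow> Q (\<lambda>x. c m x - c n x) \<le> (e/2)\<^sup>2"
      using small[of "(e/2)\<^sup>2"] e by auto
    obtain M where M: "inverse (real (Suc M)) < e/2" using reals_Archimedean[of "e/2"] e by auto
    \<comment> \<open>From \<open>N\<close> on the approximant has norm at most \<open>e/2\<close>,
      and from \<open>M\<close> on it lies within \<open>e/2\<close> of \<open>u\<close>.\<close>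
    define n where "n = max N M"
    have "Q (c n) \<le> (e/2)\<^sup>2"
      by (rule Q_le_of_Cauchy[OF c c F0 g, of N]) (auto intro: N simp: n_def)
    then have "ip_norm ipb (lincomb (c n) KB) \<le> e/2" by (rule power2_le_imp_le) (use e in simp)
    moreover have "inverse (real (Suc n)) \<le> inverse (real (Suc M))" by (simp add: n_def le_imp_inverse_le)
    then have "ip_norm ipb (\<lambda>x. u x - lincomb (c n) KB x) < e/2"
      using cu[of n] M B.ip_norm_diff_commute[OF lincomb_KB_mem[OF c] u, of n] by linarith
    moreover have "ip_norm ipb u \<le> ip_norm ipb (lincomb (c n) KB) + ip_norm ipb (\<lambda>x. u x - lincomb (c n) KB x)"
      using B.ip_norm_triangle[OF lincomb_KB_mem[OF c] B.diff_mem[OF u lincomb_KB_mem[OF c]], of n n] by simp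
    ultimately show ?thesis by simp
  qed
  then have "ip_norm ipb u \<le> 0" by (rule field_le_epsilon) simp
  then have "ip_norm ipb u = 0" using B.ip_norm_nonneg[OF u] by simp
  then show ?thesis by (rule ip_norm_eq_0_imp[OF Hb u])
qed

lemma kernels_dense: "dense_in_space (function_span {K z | z. z \<in> \<Omega>}) Hb ipb"
proof (rule B.dense_if_orthogonal_trivial[OF complete_Hb])
  show "function_span {K z | z. z \<in> \<Omega>} \<subseteq> Hb"
    unfolding function_span_def using kernel_mem_Hb(1) by (auto intro!: B.sum_mem)
  show "u = (\<lambda>x. 0)" if "u \<in> Hb" "\<And>v. v \<in> function_span {K z | z. z \<in> \<Omega>} \<Longrightarrow> ipb v u = 0" for u
    by (rule orthogonal_to_kernels_imp_zero[OF that(1)], rule that(2), rule function_span_superset) blast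
qed (auto intro: function_span_zero function_span_add function_span_scale)

end

theorem theorem7:
  fixes \<Omega> :: "(complex ^ 'd) set"
    and \<mu> :: "(complex ^ 'd) measure"
    and k :: "complex ^ 'd \<Rightarrow> complex ^ 'd \<Rightarrow> complex"
    and b :: "complex ^ 'd \<Rightarrow> nat \<Rightarrow> complex"
    and z0 :: "complex ^ 'd"
    and Hb :: "(complex ^ 'd \<Rightarrow> complex) set"
    and ipb :: "(complex ^ 'd) fun_inner"
  assumes "domain_in_Cd \<Omega>"
    and "regular_borel_measure_on \<Omega> \<mu>"
    and "closed_in_L2 \<mu> (L2a \<Omega> \<mu>)"
    and "bounded_point_evaluations \<Omega> (L2a \<Omega> \<mu>) (L2_inner \<mu>)"
    and "reproducing_kernel \<Omega> (L2a \<Omega> \<mu>) (L2_inner \<mu>) k"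
    and "dominates_lebesgue_locally \<Omega> \<mu>"
    and "analytic_row_contraction \<Omega> b"
    and "z0 \<in> \<Omega>"
    and "ell2_norm (b z0) < 1"
    and "hilbert_function_space \<Omega> Hb ipb"
    and "reproducing_kernel \<Omega> Hb ipb (row_contraction_kernel k b)"
  shows "dense_in_space (function_span {kernel_at \<Omega> k z | z. z \<in> \<Omega>}) Hb ipb"
proof -
  interpret bergman_row_contraction \<Omega> \<mu> k b Hb ipb
  proof
    show "open \<Omega>" using assms(1) by (simp add: domain_in_Cd_def)
    show "sets \<mu> = sets (restrict_space borel \<Omega>)" using assms(2) by (simp add: regular_borel_measure_on_def)
    show "ell2_analytic_on \<Omega> b" using assms(7) by (simp add: analytic_row_contraction_def)
    \<comment> \<open>The maximum principle extends the strict bound from \<open>z0\<close> to all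
      of \<Omega>.\<close>
    show "ell2_norm (b z) < 1" if "z \<in> \<Omega>" for z
      by (rule analytic_row_contraction_norm_less_1[OF assms(7,1,8,9) that])
  qed (rule assms)+
  show ?thesis by (rule kernels_dense)
qed

end
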